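(* If $G$ is a finite $Z$-group and the cyclic graph $\Delta(G)$ is connected, then $\operatorname{diam}(\Delta(G))\le 4$.
   Context: A $Z$-group is a group in which every Sylow subgroup is cyclic. For a group $G$, the cyclic graph $\Delta(G)$ is the simple graph whose vertex set is $G^{\#}=G\setminus\{1\}$, with an edge between distinct vertices $x,y$ if and only if the subgroup $\langle x,y\rangle$ is cyclic. The diameter $\operatorname{diam}$ of a connected graph is the maximum distance (length of a shortest path) between two vertices. *)

theory Defs
  imports "HOL-Computational_Algebra.Primes" "HOL-Algebra.Sylow" "HOL-Algebra.Elementary_Groups"
    "Graph_Theory.Graph_Theory"
begin

(* Intended for finite groups only: for an infinite carrier, order G = 0 and
   the definition degenerates. For a prime not dividing order G the Sylow
   subgroup is trivial. *)
definition sylow_subgroup :: "('a, 'b) monoid_scheme \<Rightarrow> nat \<Rightarrow> 'a set \<Rightarrow> bool" where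
  "sylow_subgroup G p P \<longleftrightarrow>
     Factorial_Ring.prime p \<and> subgroup P G \<and> card P = p ^ multiplicity p (order G)"

definition Z_group :: "('a, 'b) monoid_scheme \<Rightarrow> bool" where
  "Z_group G \<longleftrightarrow>
     group G \<and> (\<forall>p P. sylow_subgroup G p P \<longrightarrow> cyclic_group (G\<lparr>carrier := P\<rparr>))"

(* An undirected edge {x, y} is represented by the two arcs (x, y) and (y, x). *)
definition cyclic_graph :: "('a, 'b) monoid_scheme \<Rightarrow> 'a pair_pre_digraph" where
  "cyclic_graph G =
     \<lparr> pverts = carrier G - {\<one>\<^bsub>G\<^esub>},
       parcs = {(x, y). x \<in> carrier G - {\<one>\<^bsub>G\<^esub>} \<and> y \<in> carrier G - {\<one>\<^bsub>G\<^esub>} \<and> x \<noteq> y \<and>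
                        cyclic_group (subgroup_generated G {x, y})} \<rparr>"

lemma pair_bidirected_digraph_cyclic_graph: "pair_bidirected_digraph (cyclic_graph G)"
  by unfold_locales
     (auto simp: cyclic_graph_def symmetric_def insert_commute intro!: symI)

lemma pair_graph_cyclic_graph:
  assumes "finite (carrier G)"
  shows "pair_graph (cyclic_graph G)"
proof -
  interpret pair_bidirected_digraph "cyclic_graph G"
    by (rule pair_bidirected_digraph_cyclic_graph)
  have "parcs (cyclic_graph G) \<subseteq> carrier G \<times> carrier G"
    by (auto simp: cyclic_graph_def)
  with assms have "finite (parcs (cyclic_graph G))"
    by (meson finite_SigmaI finite_subset)
  with assms show ?thesis
    by unfold_locales (auto simp: cyclic_graph_def)
qed

(* With unit arc weights the cost of a walk is its length, so the shortest-path
   cost is the graph distance (infinite between different components). *)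
definition graph_dist :: "('a, 'b) pre_digraph \<Rightarrow> 'a \<Rightarrow> 'a \<Rightarrow> ereal" where
  "graph_dist G u v = wf_digraph.\<mu> G (\<lambda>_. 1) u v"

(* For a finite nonempty vertex set the supremum is a maximum. *)
definition diam :: "('a, 'b) pre_digraph \<Rightarrow> ereal" where
  "diam G = (SUP (u, v) \<in> verts G \<times> verts G. graph_dist G u v)"

end

theory Submission
  imports Defs "HOL-Number_Theory.Totient" "HOL-Algebra.Multiplicative_Group"
begin

text \<open>
In a finite \<open>Z\<close>-group two commuting elements generate an abelian group with cyclic Sylow
subgroups, hence a cyclic group, so the cyclic graph is the commuting graph on the nonidentity
elements.  The argument has two parts.

The first part is that \<open>G' = derived G (carrier G)\<close> is abelian (\<open>derived_commuting\<close>).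
The hypothesis enters through one consequence: whenever a prime power divides the order
of a subgroup, the subgroup has an element of that order (\<open>has_prime_power_orders\<close>).  It passes to
subgroups by definition, and to quotients by normal Hall subgroups.  A count shows that if
\<open>|G| = k m\<close> with every prime divisor of \<open>k\<close> smaller than every prime divisor of \<open>m\<close>, then
\<open>x^m = 1\<close> has exactly \<open>m\<close> solutions (\<open>card_roots_large_primes\<close>).  For \<open>m\<close> the full power of the
largest prime, this makes a Sylow subgroup normal.  Climbing through the quotients by normal Hall
subgroups one gets a normal series with cyclic factors of pairwise coprime orders.  Along it the
commutator \<open>[c, d]\<close> of two commutators is pushed down to the identity: commutators act
trivially on a cyclic normal subgroup \<open>Q\<close>, so if \<open>[c, d]\<close> lies in \<open>Q\<close> and \<open>n = |G : Q|\<close> is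
coprime to \<open>|Q|\<close>, then \<open>[c, d]^n = [c^n, d] = 1\<close> forces \<open>[c, d] = 1\<close>.

The second part works for every finite group with an abelian normal subgroup \<open>A\<close> containing all
commutators.  If no nonidentity element of \<open>A\<close> commutes with an element outside \<open>A\<close>, then the
nonidentity elements of \<open>A\<close> form a union of components, so either \<open>A\<close> is trivial or connectedness
gives \<open>G = A\<close>; in both cases \<open>G\<close> is abelian.
Otherwise fix such a pair, \<open>b\<close> outside \<open>A\<close> and \<open>z \<noteq> 1\<close> in \<open>A\<close>.  Every \<open>x\<close> then has a nonidentity
neighbour commuting with \<open>z\<close> (\<open>exists_common_neighbour\<close>): either \<open>x\<close> commutes with some
\<open>a \<noteq> 1\<close> in \<open>A\<close>, or \<open>f \<mapsto> [f, x]\<close> is a bijection of \<open>A\<close>, and this provides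
an \<open>f\<close> in \<open>A\<close> such that \<open>b f\<close> commutes with \<open>x\<close>; and \<open>b f\<close> commutes with \<open>z\<close> as \<open>A\<close> is abelian.
Hence any two vertices are joined through \<open>z\<close> by a path of length at most four.
\<close>

section \<open>Orders, roots and centralizers\<close>

lemma (in group) ord_mult_coprime:
  assumes x: "x \<in> carrier G" and y: "y \<in> carrier G" and comm: "x \<otimes> y = y \<otimes> x"
    and cop: "coprime (ord x) (ord y)"
  shows "ord (x \<otimes> y) = ord x * ord y"
proof (rule dvd_antisym)
  show "ord (x \<otimes> y) dvd ord x * ord y"
    using ord_mul_divides[OF comm x y] .
  let ?n = "ord (x \<otimes> y)"
  have split: "(x \<otimes> y) [^] i = x [^] i \<otimes> y [^] i" for i :: nat
    using pow_mult_distrib[OF comm x y] .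
  have *: "(x \<otimes> y) [^] (?n * i) = \<one>" for i
    using x y by (metis dvd_triv_left m_closed pow_eq_id)
  have "x [^] (?n * ord y) = \<one>"
    using *[of "ord y"] x y split[of "?n * ord y"] pow_eq_id[OF y, of "?n * ord y"] by simp
  then have "ord x dvd ?n"
    using cop by (simp add: pow_eq_id[OF x] coprime_dvd_mult_left_iff)
  have "y [^] (?n * ord x) = \<one>"
    using *[of "ord x"] x y split[of "?n * ord x"] pow_eq_id[OF x, of "?n * ord x"] by simp
  then have "ord y dvd ?n"
    using cop by (simp add: pow_eq_id[OF y] coprime_dvd_mult_left_iff coprime_commute)
  then show "ord x * ord y dvd ?n"
    using \<open>ord x dvd ?n\<close> cop by (simp add: divides_mult)
qed

context group
begin

definition roots :: "'a set \<Rightarrow> nat \<Rightarrow> 'a set" where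
  "roots H n = {x \<in> H. x [^] n = \<one>}"

definition cent :: "'a set \<Rightarrow> 'a \<Rightarrow> 'a set" where
  "cent H u = {x \<in> H. x \<otimes> u = u \<otimes> x}"

lemma subgroup_pow_closed: "subgroup H G \<Longrightarrow> x \<in> H \<Longrightarrow> x [^] (n::nat) \<in> H"
  by (induction n) (auto intro: subgroup.m_closed subgroup.one_closed)

lemma inv_comm:
  assumes "a \<in> carrier G" "u \<in> carrier G" "a \<otimes> u = u \<otimes> a"
  shows "inv a \<otimes> u = u \<otimes> inv a"
  using assms by (metis inv_closed inv_solve_left inv_solve_right m_assoc m_closed)

lemma subgroup_cent:
  assumes H: "subgroup H G" and u: "u \<in> carrier G"
  shows "subgroup (cent H u) G"
proof (rule subgroupI)
  show "cent H u \<subseteq> carrier G" using subgroup.subset[OF H] by (auto simp: cent_def)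
  show "cent H u \<noteq> {}" using subgroup.one_closed[OF H] u by (auto simp: cent_def)
next
  fix a assume "a \<in> cent H u"
  then have a: "a \<in> H" "a \<in> carrier G" "a \<otimes> u = u \<otimes> a"
    using subgroup.subset[OF H] by (auto simp: cent_def)
  have "inv a \<otimes> u = u \<otimes> inv a"
    using a u by (simp add: inv_comm)
  then show "inv a \<in> cent H u"
    using a subgroup.m_inv_closed[OF H] by (auto simp: cent_def)
next
  fix a b assume "a \<in> cent H u" "b \<in> cent H u"
  then have a: "a \<in> H" "a \<in> carrier G" "a \<otimes> u = u \<otimes> a" and
    b: "b \<in> H" "b \<in> carrier G" "b \<otimes> u = u \<otimes> b"
    using subgroup.subset[OF H] by (auto simp: cent_def)
  have "a \<otimes> b \<otimes> u = u \<otimes> (a \<otimes> b)"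
    using a b u by (metis m_assoc)
  then show "a \<otimes> b \<in> cent H u"
    using a b subgroup.m_closed[OF H] by (auto simp: cent_def)
qed

lemma ord_dvd_card_subgroup:
  assumes H: "subgroup H G" and x: "x \<in> H"
  shows "ord x dvd card H"
proof -
  interpret K: group "G\<lparr>carrier := H\<rparr>" using subgroup_imp_group[OF H] .
  have "x [^] card H = \<one>"
    using K.pow_order_eq_1[of x] x by (simp add: order_def nat_pow_consistent[symmetric])
  then show ?thesis using subgroup.mem_carrier[OF H x] by (simp add: pow_eq_id)
qed

text \<open>
An element whose order divides \<open>n m\<close>, with \<open>n\<close> and \<open>m\<close> coprime, is uniquely the product of
commuting elements with orders dividing \<open>n\<close> and \<open>m\<close>; sorting by the first factor gives the sum.
\<close>
lemma card_roots_coprime_mult: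
  assumes H: "subgroup H G" and fin: "finite H" and cop: "coprime (n::nat) m" "n > 0" "m > 0"
  shows "card (roots H (n * m)) = (\<Sum>u\<in>roots H n. card (roots (cent H u) m))"
proof -
  have Hc: "x \<in> H \<Longrightarrow> x \<in> carrier G" for x using subgroup.mem_carrier[OF H] .
  obtain s where s: "[m * s = 1] (mod n)"
    using cong_solve_coprime_nat[of m n] cop(1) by (auto simp: coprime_commute)
  obtain t where t: "[n * t = 1] (mod m)"
    using cong_solve_coprime_nat[of n m] cop(1) by auto
  \<comment> \<open>The powers \<open>x^e\<close> and \<open>x^d\<close> recover the two factors of \<open>x\<close>, because \<open>e\<close> is \<open>1\<close> modulo \<open>n\<close>
    and \<open>0\<close> modulo \<open>m\<close>, and \<open>d\<close> is \<open>0\<close> modulo \<open>n\<close> and \<open>1\<close> modulo \<open>m\<close>.\<close>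
  define e where "e = m * s"
  define d where "d = n * t"
  have pow_cong: "x [^] i = x [^] j" if "x \<in> carrier G" "x [^] k = \<one>" "[i = j] (mod k)"
    for x and i j k :: nat
  proof -
    have "ord x dvd k" using that pow_eq_id by blast
    then have "[i = j] (mod ord x)" using that(3) cong_dvd_modulus_nat by blast
    then have "int (ord x) dvd int j - int i"
      by (metis cong_iff_dvd_diff cong_int_iff cong_sym)
    then show ?thesis using int_pow_eq[OF that(1), of "int i" "int j"] by (simp add: int_pow_int)
  qed
  have ed: "[e + d = 1] (mod n * m)"
  proof (rule coprime_cong_mult_nat)
    show "[e + d = 1] (mod n)"
      using s by (simp add: e_def d_def cong_def)
    show "[e + d = 1] (mod m)"
      using t by (simp add: e_def d_def cong_def)
  qed (use cop in auto)
  let ?S = "SIGMA u:roots H n. roots (cent H u) m"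
  have "bij_betw (\<lambda>(u, v). u \<otimes> v) ?S (roots H (n * m))"
  proof (rule bij_betw_byWitness[where f' = "\<lambda>x. (x [^] e, x [^] d)"])
    show "\<forall>p\<in>?S. (\<lambda>x. (x [^] e, x [^] d)) ((\<lambda>(u, v). u \<otimes> v) p) = p"
    proof clarsimp
      fix u v assume "u \<in> roots H n" "v \<in> roots (cent H u) m"
      then have u: "u \<in> carrier G" "u [^] n = \<one>" and v: "v \<in> carrier G" "v [^] m = \<one>"
        and c: "u \<otimes> v = v \<otimes> u" by (auto simp: roots_def cent_def Hc)
      have 1: "v [^] e = \<one>" "u [^] d = \<one>"
        using u v by (simp_all add: e_def d_def nat_pow_pow[symmetric])
      have "u [^] e = u [^] (1::nat)" "v [^] d = v [^] (1::nat)"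
        using s t u v pow_cong unfolding e_def d_def by blast+
      then show "(u \<otimes> v) [^] e = u \<and> (u \<otimes> v) [^] d = v"
        using u v 1 by (simp add: pow_mult_distrib[OF c])
    qed
    show "\<forall>x\<in>roots H (n * m). (\<lambda>(u, v). u \<otimes> v) (x [^] e, x [^] d) = x"
    proof clarsimp
      fix x assume "x \<in> roots H (n * m)"
      then have x: "x \<in> carrier G" "x [^] (n * m) = \<one>" by (auto simp: roots_def Hc)
      have "x [^] (e + d) = x [^] (1::nat)" using pow_cong[OF x ed] .
      then show "x [^] e \<otimes> x [^] d = x" using x by (simp add: nat_pow_mult)
    qed
    show "(\<lambda>(u, v). u \<otimes> v) ` ?S \<subseteq> roots H (n * m)"
    proof clarsimp
      fix u v assume "u \<in> roots H n" "v \<in> roots (cent H u) m"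
      then have u: "u \<in> H" "u \<in> carrier G" "u [^] n = \<one>"
        and v: "v \<in> H" "v \<in> carrier G" "v [^] m = \<one>"
        and c: "u \<otimes> v = v \<otimes> u" by (auto simp: roots_def cent_def Hc)
      have "u [^] (n * m) = \<one>" "v [^] (n * m) = \<one>"
        using u v by (simp add: nat_pow_pow[symmetric], metis v(2,3) mult.commute nat_pow_one nat_pow_pow)
      then show "u \<otimes> v \<in> roots H (n * m)"
        using u v pow_mult_distrib[OF c u(2) v(2)] subgroup.m_closed[OF H] by (simp add: roots_def)
    qed
    show "(\<lambda>x. (x [^] e, x [^] d)) ` roots H (n * m) \<subseteq> ?S"
    proof clarsimp
      fix x assume "x \<in> roots H (n * m)"
      then have x: "x \<in> H" "x \<in> carrier G" "x [^] (n * m) = \<one>" by (auto simp: roots_def Hc)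
      have "(x [^] e) [^] n = (x [^] (n * m)) [^] s" "(x [^] d) [^] m = (x [^] (n * m)) [^] t"
        using x(2) by (simp_all add: nat_pow_pow e_def d_def mult_ac)
      moreover have "x [^] d \<otimes> x [^] e = x [^] e \<otimes> x [^] d"
        using x nat_pow_comm by blast
      ultimately show "x [^] e \<in> roots H n \<and> x [^] d \<in> roots (cent H (x [^] e)) m"
        using x by (simp add: roots_def cent_def subgroup_pow_closed[OF H])
    qed
  qed
  then have "card (roots H (n * m)) = card ?S"
    by (rule bij_betw_same_card[symmetric])
  also have "\<dots> = (\<Sum>u\<in>roots H n. card (roots (cent H u) m))"
    by (rule card_SigmaI) (use fin in \<open>auto simp: roots_def cent_def\<close>)
  finally show ?thesis .
qed

definition conj_class :: "'a set \<Rightarrow> 'a \<Rightarrow> 'a set" where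
  "conj_class H u = (\<lambda>h. h \<otimes> u \<otimes> inv h) ` H"

text \<open>
The elements of \<open>H\<close> that conjugate \<open>u\<close> to a given conjugate form a left coset of the centralizer.
\<close>
lemma card_conj_class:
  assumes H: "subgroup H G" and fin: "finite H" and u: "u \<in> carrier G"
  shows "card (conj_class H u) * card (cent H u) = card H"
proof -
  have Hc: "x \<in> H \<Longrightarrow> x \<in> carrier G" for x using subgroup.mem_carrier[OF H] .
  let ?f = "\<lambda>h. h \<otimes> u \<otimes> inv h"
  have fib: "card {x \<in> H. ?f x = w} = card (cent H u)" if w: "w \<in> conj_class H u" for w
  proof -
    obtain h where h: "h \<in> H" "w = ?f h" using w by (auto simp: conj_class_def)
    note hc = Hc[OF h(1)]
    have iff: "?f (h \<otimes> x) = ?f h \<longleftrightarrow> x \<otimes> u = u \<otimes> x" if "x \<in> carrier G" for x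
    proof -
      have "?f (h \<otimes> x) = h \<otimes> (x \<otimes> u \<otimes> inv x) \<otimes> inv h"
        using that u hc by (simp add: inv_mult_group m_assoc)
      then have "?f (h \<otimes> x) = ?f h \<longleftrightarrow> x \<otimes> u \<otimes> inv x = u"
        using that u hc by simp
      then show ?thesis using that u by (metis inv_closed inv_solve_right m_closed)
    qed
    have "bij_betw ((\<otimes>) h) (cent H u) {x \<in> H. ?f x = w}"
    proof (rule bij_betwI')
      show "(h \<otimes> x = h \<otimes> y) = (x = y)" if "x \<in> cent H u" "y \<in> cent H u" for x y
        using that hc Hc by (auto simp: cent_def)
      show "h \<otimes> x \<in> {x \<in> H. ?f x = w}" if "x \<in> cent H u" for x
        using that h iff[of x] subgroup.m_closed[OF H] Hc by (auto simp: cent_def)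
      show "\<exists>x\<in>cent H u. y = h \<otimes> x" if "y \<in> {x \<in> H. ?f x = w}" for y
      proof (rule bexI)
        have y: "y \<in> H" "y \<in> carrier G" "?f y = w" using that Hc by auto
        show eq: "y = h \<otimes> (inv h \<otimes> y)" using y hc by (simp add: m_assoc[symmetric])
        have "inv h \<otimes> y \<in> H" using H h y by (simp add: subgroup.m_closed subgroup.m_inv_closed)
        then show "inv h \<otimes> y \<in> cent H u"
          using iff[of "inv h \<otimes> y"] eq y h Hc by (auto simp: cent_def)
      qed
    qed
    then show ?thesis by (rule bij_betw_same_card[symmetric])
  qed
  have "card H = (\<Sum>w\<in>conj_class H u. card {x \<in> H. ?f x = w})"
    using sum.group[of H "conj_class H u" ?f "\<lambda>_. 1::nat"] fin
    by (simp add: conj_class_def)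
  then show ?thesis using fib by simp
qed

end

text \<open>
Used both for orbit counts, where \<open>g\<close> sends a point to its orbit, and for sorting elements by the
cyclic subgroup that they generate.
\<close>
lemma dvd_sum_fibres:
  fixes w :: "'a \<Rightarrow> nat"
  assumes "finite S" and "\<And>x. x \<in> S \<Longrightarrow> k dvd (\<Sum>y\<in>{y \<in> S. g y = g x}. w y)"
  shows "k dvd sum w S"
proof -
  have "sum w S = (\<Sum>z\<in>g ` S. \<Sum>y\<in>{y \<in> S. g y = z}. w y)"
    using sum.group[of S "g ` S" g w] assms(1) by simp
  also have "k dvd \<dots>"
    by (rule dvd_sum) (use assms(2) in blast)
  finally show ?thesis .
qed

context group
begin

lemma exists_element_of_prime_order:
  assumes K: "subgroup K G" and fin: "finite K" and r: "Factorial_Ring.prime r" "r dvd card K"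
  shows "\<exists>x\<in>K. ord x = r"
proof -
  interpret K: group "G\<lparr>carrier := K\<rparr>" using subgroup_imp_group[OF K] .
  obtain c where "card K = r ^ 1 * c" using r(2) by (auto elim: dvdE)
  then obtain L where "subgroup L (G\<lparr>carrier := K\<rparr>)" and cL: "card L = r ^ 1"
    using sylow_thm[OF r(1) K.is_group, of 1 c] fin by (auto simp: order_def)
  then have L: "subgroup L G" "L \<subseteq> K"
    using incl_subgroup[OF K] subgroup.subset by force+
  have "finite L" using L(2) fin finite_subset by blast
  have "\<not> L \<subseteq> {\<one>}"
    using cL prime_gt_1_nat[OF r(1)] card_mono[of "{\<one>}" L] by auto
  then obtain x where x: "x \<in> L" "x \<noteq> \<one>" by blast
  then have "ord x dvd r" "ord x \<noteq> 1"
    using ord_dvd_card_subgroup[OF L(1) x(1)] cL ord_eq_1 subgroup.mem_carrier[OF L(1)] by auto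
  then have "ord x = r" using r(1) prime_nat_iff by blast
  then show ?thesis using x L by auto
qed

text \<open>
The generators of \<open>generate G {u}\<close> are the powers \<open>u^i\<close> with \<open>i\<close> coprime to the order of \<open>u\<close>.
\<close>
lemma card_generators_of_cyclic:
  assumes H: "subgroup H G" and fin: "finite (carrier G)" and u: "u \<in> H"
  shows "card {y \<in> H. ord y = ord u \<and> generate G {y} = generate G {u}} = totient (ord u)"
proof -
  let ?d = "ord u"
  have uc: "u \<in> carrier G" using subgroup.mem_carrier[OF H u] .
  have d: "?d > 0" using ord_ge_1[OF fin uc] by simp
  have "bij_betw (\<lambda>i. u [^] i) (totatives ?d)
      {y \<in> H. ord y = ord u \<and> generate G {y} = generate G {u}}"
    unfolding bij_betw_def
  proof
    show "inj_on (\<lambda>i. u [^] i) (totatives ?d)"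
      by (rule inj_on_subset[OF ord_inj'[OF uc]]) (auto simp: totatives_def)
    show "(\<lambda>i. u [^] i) ` totatives ?d
        = {y \<in> H. ord y = ord u \<and> generate G {y} = generate G {u}}" (is "?L = ?R")
    proof
      show "?L \<subseteq> ?R"
      proof clarsimp
        fix i assume "i \<in> totatives ?d"
        then have o: "ord (u [^] i) = ?d"
          using pow_ord_eq_ord_iff[OF fin uc] by (simp add: totatives_def)
        have "u [^] i \<in> generate G {u}"
          using generate_pow_on_finite_carrier[OF fin uc] by auto
        then have "generate G {u [^] i} \<subseteq> generate G {u}"
          using generate_subgroup_incl[of "{u [^] i}"] generate_is_subgroup[of "{u}"] uc by auto
        moreover have "card (generate G {u [^] i}) = card (generate G {u})"
          using generate_pow_card[OF uc] generate_pow_card[of "u [^] i"] uc o by simp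
        moreover have "finite (generate G {u})"
          using generate_in_carrier[of "{u}"] uc fin finite_subset by (metis empty_subsetI generate_incl insert_subset)
        ultimately have "generate G {u [^] i} = generate G {u}"
          by (metis card_subset_eq)
        then show "u [^] i \<in> H \<and> ord (u [^] i) = ?d \<and> generate G {u [^] i} = generate G {u}"
          using o subgroup_pow_closed[OF H u] by simp
      qed
      show "?R \<subseteq> ?L"
      proof clarsimp
        fix y assume y: "y \<in> H" "ord y = ord u" "generate G {y} = generate G {u}"
        then have "y \<in> generate G {u}" using generate.incl[of y "{y}"] by auto
        then obtain k :: nat where k: "y = u [^] k"
          using generate_pow_on_finite_carrier[OF fin uc] by auto
        \<comment> \<open>\<open>totatives\<close> takes its representatives from \<open>1\<close> to \<open>d\<close>, so the residue \<open>0\<close> is replaced by \<open>d\<close>.\<close>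
        define j where "j = (if k mod ?d = 0 then ?d else k mod ?d)"
        have j: "0 < j" "j \<le> ?d" using d by (auto simp: j_def less_imp_le)
        have "[k = j] (mod ?d)" by (simp add: j_def cong_def)
        then have "int ?d dvd int j - int k"
          by (metis cong_iff_dvd_diff cong_int_iff cong_sym)
        then have yj: "y = u [^] j"
          using int_pow_eq[OF uc, of "int k" "int j"] k by (simp add: int_pow_int)
        then have "coprime j ?d"
          using y(2) pow_ord_eq_ord_iff[OF fin uc] by simp
        then show "y \<in> ?L" using j yj by (auto simp: totatives_def)
      qed
    qed
  qed
  then show ?thesis unfolding totient_def by (rule bij_betw_same_card[symmetric])
qed

lemma cent_cong_generate:
  assumes fin: "finite (carrier G)" and H: "subgroup H G"
    and u: "u \<in> carrier G" and y: "y \<in> carrier G" and eq: "generate G {y} = generate G {u}"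
  shows "cent H y = cent H u"
proof -
  have *: "cent H u \<subseteq> cent H y" if uy: "u \<in> carrier G" "y \<in> generate G {u}" for u y
  proof
    fix x assume x: "x \<in> cent H u"
    obtain k :: nat where "y = u [^] k"
      using uy generate_pow_on_finite_carrier[OF fin uy(1)] by auto
    then show "x \<in> cent H y"
      using x uy(1) group_commutes_pow[of u x k] subgroup.mem_carrier[OF H] by (auto simp: cent_def)
  qed
  have "y \<in> generate G {u}" "u \<in> generate G {y}"
    using eq generate.incl[of y "{y}"] generate.incl[of u "{u}"] by auto
  then show ?thesis using *[OF u] *[OF y] by blast
qed

lemma roots_subset: "roots H n \<subseteq> H" by (auto simp: roots_def)

lemma roots_gcd:
  assumes H: "subgroup H G"
  shows "roots H n = roots H (gcd n (card H))"
  using subgroup.mem_carrier[OF H] ord_dvd_card_subgroup[OF H]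
  by (auto simp: roots_def pow_eq_id)

lemma conj_pow:
  assumes "h \<in> carrier G" "x \<in> carrier G"
  shows "(h \<otimes> x \<otimes> inv h) [^] (n::nat) = h \<otimes> x [^] n \<otimes> inv h"
proof (induction n)
  case (Suc n)
  have "(h \<otimes> x \<otimes> inv h) [^] Suc n = h \<otimes> x [^] n \<otimes> inv h \<otimes> (h \<otimes> x \<otimes> inv h)"
    using Suc by simp
  also have "\<dots> = h \<otimes> x [^] n \<otimes> (inv h \<otimes> h) \<otimes> x \<otimes> inv h"
    using assms by (simp only: m_assoc inv_closed m_closed nat_pow_closed)
  also have "\<dots> = h \<otimes> x [^] Suc n \<otimes> inv h"
    using assms by (simp add: m_assoc)
  finally show ?case .
qed (use assms in simp)

lemma ord_conj:
  assumes "h \<in> carrier G" "x \<in> carrier G"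
  shows "ord (h \<otimes> x \<otimes> inv h) = ord x"
proof -
  have "(h \<otimes> x \<otimes> inv h) [^] n = \<one> \<longleftrightarrow> x [^] n = \<one>" for n :: nat
  proof -
    have "h \<otimes> x [^] n \<otimes> inv h = \<one> \<longleftrightarrow> h \<otimes> x [^] n = h"
      using assms by (metis inv_closed inv_solve_right l_one m_closed nat_pow_closed one_closed)
    also have "\<dots> \<longleftrightarrow> x [^] n = \<one>" using assms by simp
    finally show ?thesis using conj_pow[OF assms] by simp
  qed
  then show ?thesis using assms ord_unique[of "h \<otimes> x \<otimes> inv h" "ord x"] by (simp add: pow_eq_id)
qed

lemma conj_class_self:
  assumes H: "subgroup H G" and u: "u \<in> carrier G"
  shows "u \<in> conj_class H u"
  unfolding conj_class_def
  by (rule image_eqI[of _ _ \<one>]) (use subgroup.one_closed[OF H] u in auto)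

lemma conj_class_eq:
  assumes H: "subgroup H G" and u: "u \<in> carrier G" and y: "y \<in> conj_class H u"
  shows "conj_class H y = conj_class H u"
proof -
  have Hc: "x \<in> H \<Longrightarrow> x \<in> carrier G" for x using subgroup.mem_carrier[OF H] .
  obtain h where h: "h \<in> H" "y = h \<otimes> u \<otimes> inv h" using y by (auto simp: conj_class_def)
  have sub: "conj_class H y \<subseteq> conj_class H u"
    if h: "h \<in> H" "y = h \<otimes> u \<otimes> inv h" and u: "u \<in> carrier G" for h u y
  proof
    fix x assume "x \<in> conj_class H y"
    then obtain g where g: "g \<in> H" "x = g \<otimes> y \<otimes> inv g" by (auto simp: conj_class_def)
    then have "x = (g \<otimes> h) \<otimes> u \<otimes> inv (g \<otimes> h)"
      using h u Hc by (simp add: inv_mult_group m_assoc)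
    then show "x \<in> conj_class H u"
      using g h subgroup.m_closed[OF H] by (auto simp: conj_class_def)
  qed
  have "u = inv h \<otimes> y \<otimes> inv (inv h)"
    using h u Hc by (simp add: m_assoc) (simp add: m_assoc[symmetric])
  then have "conj_class H u \<subseteq> conj_class H y"
    using sub[of "inv h" u y] h Hc u subgroup.m_inv_closed[OF H] by auto
  then show ?thesis using sub[OF h u] by blast
qed

lemma subgroup_central_roots:
  assumes H: "subgroup H G"
  shows "subgroup {u \<in> roots H n. cent H u = H} G"
proof (rule subgroupI)
  have Hc: "x \<in> H \<Longrightarrow> x \<in> carrier G" for x using subgroup.mem_carrier[OF H] .
  let ?Z = "{u \<in> roots H n. cent H u = H}"
  have mem: "u \<in> ?Z \<longleftrightarrow> u \<in> H \<and> u [^] n = \<one> \<and> (\<forall>x\<in>H. x \<otimes> u = u \<otimes> x)" for u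
    by (auto simp: roots_def cent_def)
  show "?Z \<subseteq> carrier G" using Hc by (auto simp: roots_def)
  have "\<one> \<in> ?Z" unfolding mem using subgroup.one_closed[OF H] Hc by simp
  then show "?Z \<noteq> {}" by blast
  fix a assume a: "a \<in> ?Z"
  then have a': "a \<in> H" "a \<in> carrier G" "a [^] n = \<one>" "\<And>x. x \<in> H \<Longrightarrow> x \<otimes> a = a \<otimes> x"
    using Hc unfolding mem by auto
  have "x \<otimes> inv a = inv a \<otimes> x" if "x \<in> H" for x
    using inv_comm[OF a'(2) Hc[OF that]] a'(4)[OF that] by simp
  then show "inv a \<in> ?Z"
    unfolding mem using a'(1-3) subgroup.m_inv_closed[OF H] by (simp add: nat_pow_inv)
  fix b assume b: "b \<in> ?Z"
  then have b': "b \<in> H" "b \<in> carrier G" "b [^] n = \<one>" "\<And>x. x \<in> H \<Longrightarrow> x \<otimes> b = b \<otimes> x"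
    using Hc unfolding mem by auto
  have "x \<otimes> (a \<otimes> b) = a \<otimes> b \<otimes> x" if "x \<in> H" for x
    using a' b' that Hc[OF that] by (metis m_assoc[of x a b] m_assoc[of a x b] m_assoc[of a b x])
  moreover have "(a \<otimes> b) [^] n = \<one>"
    using pow_mult_distrib[of a b n] a'(2,3) b'(2,3) b'(4)[OF a'(1)] by simp
  ultimately show "a \<otimes> b \<in> ?Z"
    unfolding mem using a'(1) b'(1) subgroup.m_closed[OF H] by simp
qed

end

section \<open>Counting the roots of unity of a finite group\<close>

lemma obtain_common_prime_factor:
  fixes a b :: nat
  assumes "\<not> coprime a b"
  obtains r where "Factorial_Ring.prime r" "r dvd a" "r dvd b"
  using assms prime_factor_nat[of "gcd a b"] by (auto simp: coprime_iff_gcd_eq_1)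

context group
begin

text \<open>
The step that removes one prime \<open>p\<close> from the exponent.  Write \<open>f\<close> for the number of solutions
of \<open>x^m = 1\<close> in \<open>H\<close>.  Sorting the solutions of \<open>x^(p^a m) = 1\<close> by their \<open>p\<close>-part
\<open>u\<close> gives \<open>p^a m\<close> as the sum over \<open>u\<close> of \<open>w u\<close>, the number of solutions of \<open>v^m = 1\<close> in the centralizer
of \<open>u\<close>.  By the induction hypothesis on centralizers, every noncentral conjugacy class contributes a
multiple of \<open>m\<close>; the central \<open>u\<close> contribute \<open>f\<close> each, and their number is coprime to \<open>m\<close>, so
\<open>m\<close> divides \<open>f\<close>.  Hence the elements \<open>u\<close> of a fixed order \<open>d\<close> contribute a multiple of \<open>m\<close>.
They also contribute a multiple of \<open>totient d\<close>, which is coprime to \<open>m\<close> because all primes of \<open>m\<close>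
exceed \<open>p\<close>; and they contribute something, since there is an element of order \<open>d\<close>.  So the
contribution is at least \<open>totient d * m\<close>.  As the totients of the divisors of \<open>p^a\<close>
sum to \<open>p^a\<close>, the term \<open>d = 1\<close>, which is \<open>f\<close>, can be at most \<open>m\<close>.
\<close>
lemma card_roots_descend:
  assumes fin: "finite (carrier G)" and H: "subgroup H G" and p: "Factorial_Ring.prime p"
    and elts: "\<And>j. j \<le> a \<Longrightarrow> \<exists>u\<in>H. ord u = p ^ j"
    and m: "m > 0" "m dvd card H" "\<And>q. Factorial_Ring.prime q \<Longrightarrow> q dvd m \<Longrightarrow> p < q"
    and M: "card (roots H (p ^ a * m)) = p ^ a * m"
    and IH: "\<And>u. u \<in> H \<Longrightarrow> cent H u \<noteq> H \<Longrightarrow>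
        card (roots (cent H u) m) = gcd m (card (cent H u))"
  shows "card (roots H m) = m"
proof -
  have Hc: "x \<in> H \<Longrightarrow> x \<in> carrier G" for x using subgroup.mem_carrier[OF H] .
  have finH: "finite H" using fin subgroup.subset[OF H] finite_subset by blast
  have p1: "p > 1" using prime_gt_1_nat[OF p] .
  have cop: "coprime m (p ^ j)" for j
  proof -
    have "coprime p m" using m(3)[OF p] p prime_imp_coprime by blast
    then show ?thesis by (simp add: coprime_commute)
  qed
  define w where "w u = card (roots (cent H u) m)" for u
  define f where "f = card (roots H m)"
  let ?R = "roots H (p ^ a)"
  define Z where "Z = {u \<in> ?R. cent H u = H}"
  have finR: "finite ?R" using finH roots_subset finite_subset by blast
  have fpos: "f > 0"
  proof -
    have "\<one> \<in> roots H m" using subgroup.one_closed[OF H] by (simp add: roots_def)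
    then show ?thesis unfolding f_def using finH roots_subset[of H m]
      by (metis card_gt_0_iff empty_iff finite_subset)
  qed
  have total: "p ^ a * m = (\<Sum>u\<in>?R. w u)"
    using card_roots_coprime_mult[OF H finH, of "p ^ a" m] cop m(1) p1 M
    by (simp add: w_def coprime_commute)

  have w_class: "w y = w u" if y: "y \<in> conj_class H u" and u: "u \<in> H" and nc: "cent H u \<noteq> H" for u y
  proof -
    have "conj_class H y = conj_class H u" using conj_class_eq[OF H Hc[OF u] y] .
    moreover have yH: "y \<in> H"
      using y u H by (auto simp: conj_class_def intro: subgroup.m_closed subgroup.m_inv_closed)
    ultimately have "card (conj_class H u) * card (cent H y) = card (conj_class H u) * card (cent H u)"
      using card_conj_class[OF H finH Hc[OF u]] card_conj_class[OF H finH Hc[OF yH]] by simp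
    moreover have "card (conj_class H u) > 0"
      using conj_class_self[OF H Hc[OF u]] finH unfolding conj_class_def
      by (metis card_gt_0_iff empty_iff finite_imageI)
    ultimately have c: "card (cent H y) = card (cent H u)" by simp
    have "cent H y \<noteq> H"
    proof
      assume "cent H y = H"
      then have "card (cent H u) = card H" using c by simp
      then show False using nc finH card_subset_eq[of H "cent H u"] by (auto simp: cent_def)
    qed
    then show ?thesis using IH[OF yH] IH[OF u nc] c by (simp add: w_def)
  qed

  have class_dvd: "m dvd (\<Sum>y\<in>conj_class H u. w y)" if u: "u \<in> H" and nc: "cent H u \<noteq> H" for u
  proof -
    have "(\<Sum>y\<in>conj_class H u. w y) = card (conj_class H u) * gcd m (card (cent H u))"
      using w_class[OF _ u nc] IH[OF u nc] by (simp add: w_def)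
    \<comment> \<open>The class of \<open>u\<close> has \<open>|H : C|\<close> elements, \<open>C\<close> being the centralizer of \<open>u\<close> in \<open>H\<close>.\<close>
    also have "\<dots> = gcd (card (conj_class H u) * m) (card H)"
      using card_conj_class[OF H finH Hc[OF u]] by (metis gcd_mult_distrib_nat)
    finally show ?thesis using m(2) by simp
  qed

  \<comment> \<open>The predicate \<open>Q\<close> allows the same statement to serve for all \<open>p\<close>-elements at once
    and for those of one order.\<close>
  have fibre: "{y \<in> {y \<in> H. ord y dvd p ^ a \<and> Q (ord y) \<and> cent H y \<noteq> H}. conj_class H y = conj_class H u}
      = conj_class H u"
    if u: "u \<in> H" "ord u dvd p ^ a" "Q (ord u)" "cent H u \<noteq> H" for u Q
  proof (intro subset_antisym subsetI)
    fix y assume "y \<in> {y \<in> {y \<in> H. ord y dvd p ^ a \<and> Q (ord y) \<and> cent H y \<noteq> H}. conj_class H y = conj_class H u}"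
    then show "y \<in> conj_class H u" using conj_class_self[OF H] Hc by blast
  next
    fix y assume y: "y \<in> conj_class H u"
    have yH: "y \<in> H"
      using y u H by (auto simp: conj_class_def intro: subgroup.m_closed subgroup.m_inv_closed)
    have o: "ord y = ord u"
      using y ord_conj Hc u(1) by (auto simp: conj_class_def)
    have e: "conj_class H y = conj_class H u" using conj_class_eq[OF H Hc[OF u(1)] y] .
    have "cent H y \<noteq> H"
    proof
      assume "cent H y = H"
      then have "z \<otimes> y \<otimes> inv z = y" if "z \<in> H" for z
        using that yH Hc unfolding cent_def by (metis (mono_tags, lifting) inv_solve_right m_closed mem_Collect_eq)
      then have "conj_class H y \<subseteq> {y}" by (auto simp: conj_class_def)
      then have "u = y" using e conj_class_self[OF H Hc[OF u(1)]] by auto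
      then show False using u(4) \<open>cent H y = H\<close> by simp
    qed
    then show "y \<in> {y \<in> {y \<in> H. ord y dvd p ^ a \<and> Q (ord y) \<and> cent H y \<noteq> H}. conj_class H y = conj_class H u}"
      using yH o u e by simp
  qed

  have noncentral_dvd: "m dvd (\<Sum>u\<in>{u \<in> H. ord u dvd p ^ a \<and> Q (ord u) \<and> cent H u \<noteq> H}. w u)" for Q
  proof (rule dvd_sum_fibres[where g = "conj_class H"])
    show "finite {u \<in> H. ord u dvd p ^ a \<and> Q (ord u) \<and> cent H u \<noteq> H}" using finH by simp
    fix u assume "u \<in> {u \<in> H. ord u dvd p ^ a \<and> Q (ord u) \<and> cent H u \<noteq> H}"
    then have u: "u \<in> H" "ord u dvd p ^ a" "Q (ord u)" "cent H u \<noteq> H" by auto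
    show "m dvd sum w {y \<in> {y \<in> H. ord y dvd p ^ a \<and> Q (ord y) \<and> cent H y \<noteq> H}. conj_class H y = conj_class H u}"
      unfolding fibre[of u Q, OF u] using class_dvd[OF u(1,4)] .
  qed

  have R_eq: "?R = {u \<in> H. ord u dvd p ^ a}"
    using Hc by (auto simp: roots_def pow_eq_id)

  have "m dvd f"
  proof -
    have subZ: "subgroup Z G" unfolding Z_def using subgroup_central_roots[OF H] .
    have finZ: "finite Z" using finR by (simp add: Z_def)
    have copZ: "coprime m (card Z)"
    proof (rule ccontr)
      assume "\<not> coprime m (card Z)"
      then obtain r where r: "Factorial_Ring.prime r" "r dvd m" "r dvd card Z"
        by (rule obtain_common_prime_factor)
      then obtain x where x: "x \<in> Z" "ord x = r"
        using exists_element_of_prime_order[OF subZ finZ] by blast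
      then have "r dvd p ^ a" using R_eq by (auto simp: Z_def)
      then have "r = p" using r(1) p prime_dvd_power primes_dvd_imp_eq by blast
      then show False using m(3)[OF p] r by simp
    qed
    have "(\<Sum>u\<in>?R. w u) = (\<Sum>u\<in>Z. w u) + (\<Sum>u\<in>?R - Z. w u)"
      using sum.subset_diff[of Z ?R w] finR by (simp add: Z_def)
    also have "(\<Sum>u\<in>Z. w u) = card Z * f" by (simp add: w_def Z_def f_def)
    also have "?R - Z = {u \<in> H. ord u dvd p ^ a \<and> True \<and> cent H u \<noteq> H}"
      by (auto simp: R_eq Z_def)
    finally have eq: "p ^ a * m = card Z * f + (\<Sum>u\<in>{u \<in> H. ord u dvd p ^ a \<and> True \<and> cent H u \<noteq> H}. w u)"
      using total by simp
    have "m dvd p ^ a * m" by simp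
    then have "m dvd card Z * f"
      unfolding eq dvd_add_left_iff[OF noncentral_dvd[of "\<lambda>_. True"]] .
    then show ?thesis using copZ by (simp add: coprime_dvd_mult_right_iff)
  qed

  define S where "S d = (\<Sum>u\<in>{u \<in> H. ord u = d}. w u)" for d
  have S_dvd_m: "m dvd S d" if d: "d dvd p ^ a" for d
  proof -
    have "{u \<in> H. ord u = d} = {u \<in> H. ord u = d \<and> cent H u = H} \<union> {u \<in> H. ord u dvd p ^ a \<and> ord u = d \<and> cent H u \<noteq> H}"
      using d by auto
    then have "S d = (\<Sum>u\<in>{u \<in> H. ord u = d \<and> cent H u = H}. w u)
        + (\<Sum>u\<in>{u \<in> H. ord u dvd p ^ a \<and> ord u = d \<and> cent H u \<noteq> H}. w u)"
      unfolding S_def by (simp add: finH sum.union_disjoint[symmetric] disjoint_iff)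
    moreover have "m dvd (\<Sum>u\<in>{u \<in> H. ord u = d \<and> cent H u = H}. w u)"
      by (rule dvd_sum) (use \<open>m dvd f\<close> in \<open>auto simp: w_def f_def\<close>)
    ultimately show ?thesis using noncentral_dvd[of "\<lambda>k. k = d"] by simp
  qed
  have S_dvd_tot: "totient d dvd S d" for d
    unfolding S_def
  proof (rule dvd_sum_fibres[where g = "\<lambda>u. generate G {u}"])
    show "finite {u \<in> H. ord u = d}" using finH by simp
    fix u assume u: "u \<in> {u \<in> H. ord u = d}"
    have "w y = w u" if "y \<in> {y \<in> {u \<in> H. ord u = d}. generate G {y} = generate G {u}}" for y
      using that u cent_cong_generate[OF fin H, of u y] Hc by (simp add: w_def)
    then have sum_eq: "(\<Sum>y\<in>{y \<in> {u \<in> H. ord u = d}. generate G {y} = generate G {u}}. w y)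
        = card {y \<in> {u \<in> H. ord u = d}. generate G {y} = generate G {u}} * w u"
      by simp
    have "{y \<in> {u \<in> H. ord u = d}. generate G {y} = generate G {u}}
        = {y \<in> H. ord y = ord u \<and> generate G {y} = generate G {u}}"
      using u by auto
    then have card_eq: "card {y \<in> {u \<in> H. ord u = d}. generate G {y} = generate G {u}} = totient d"
      using card_generators_of_cyclic[OF H fin, of u] u by auto
    show "totient d dvd (\<Sum>y\<in>{y \<in> {u \<in> H. ord u = d}. generate G {y} = generate G {u}}. w y)"
      unfolding sum_eq card_eq by (rule dvd_triv_left)
  qed
  have S_ge: "totient d * m \<le> S d" if d: "d dvd p ^ a" for d
  proof -
    obtain j where j: "j \<le> a" "d = p ^ j" using d p divides_primepow_nat by blast
    obtain u where u: "u \<in> H" "ord u = d" using elts j by blast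
    have "w u > 0"
    proof -
      have "\<one> \<in> roots (cent H u) m"
        using subgroup.one_closed[OF H] Hc[OF u(1)] by (simp add: roots_def cent_def)
      then show ?thesis unfolding w_def using finH
        by (auto simp: card_gt_0_iff roots_def cent_def)
    qed
    then have pos: "S d > 0"
      unfolding S_def using finH u by (auto intro!: sum_pos2[of _ u])
    have "coprime (totient d) m"
    proof (rule ccontr)
      assume "\<not> coprime (totient d) m"
      then obtain r where r: "Factorial_Ring.prime r" "r dvd totient d" "r dvd m"
        by (rule obtain_common_prime_factor)
      then have "r \<le> p"
      proof (cases "j = 0")
        case False
        then have "totient d = p ^ (j - 1) * (p - 1)"
          using j totient_prime_power[OF p] by simp
        then have "r dvd p \<or> r dvd p - 1"
          using r(1,2) by (metis prime_dvd_mult_iff prime_dvd_power)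
        then show ?thesis using p1 by (auto dest: dvd_imp_le)
      qed (use r j in auto)
      then show False using m(3)[OF r(1,3)] by simp
    qed
    then have "totient d * m dvd S d"
      using S_dvd_m[OF d] S_dvd_tot by (simp add: divides_mult)
    then show ?thesis using pos dvd_imp_le by blast
  qed

  have S1: "S 1 = f"
  proof -
    have "{u \<in> H. ord u = 1} = {\<one>}"
      using Hc ord_eq_1 subgroup.one_closed[OF H] by auto
    moreover have "cent H \<one> = H" using Hc by (auto simp: cent_def)
    ultimately show ?thesis by (simp add: S_def w_def f_def)
  qed
  let ?D = "{d. d dvd p ^ a}"
  have finD: "finite ?D" using p1 by (simp add: finite_divisors_nat)
  have "p ^ a * m = (\<Sum>d\<in>?D. S d)"
  proof -
    have "(\<Sum>u\<in>?R. w u) = (\<Sum>d\<in>?D. \<Sum>u\<in>{u \<in> ?R. ord u = d}. w u)"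
      using sum.group[OF finR finD, of ord w] by (force simp: R_eq)
    also have "\<dots> = (\<Sum>d\<in>?D. S d)"
      unfolding S_def by (rule sum.cong[OF refl], rule arg_cong2[where f = sum]) (auto simp: R_eq)
    finally show ?thesis using total by simp
  qed
  also have "\<dots> = f + (\<Sum>d\<in>?D - {1}. S d)"
    using finD sum.remove[of ?D 1 S] S1 by simp
  finally have A: "p ^ a * m = f + (\<Sum>d\<in>?D - {1}. S d)" .
  have "p ^ a * m = (\<Sum>d\<in>?D. totient d * m)"
    using totient_divisor_sum[of "p ^ a"] by (simp add: sum_distrib_right[symmetric])
  also have "\<dots> = m + (\<Sum>d\<in>?D - {1}. totient d * m)"
    using finD sum.remove[of ?D 1 "\<lambda>d. totient d * m"] by simp
  finally have B: "p ^ a * m = m + (\<Sum>d\<in>?D - {1}. totient d * m)" .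
  have "(\<Sum>d\<in>?D - {1}. totient d * m) \<le> (\<Sum>d\<in>?D - {1}. S d)"
    using S_ge by (auto intro!: sum_mono)
  then have "f \<le> m" using A B by linarith
  then show ?thesis using \<open>m dvd f\<close> fpos by (simp add: f_def dvd_imp_le antisym)
qed

end

text \<open>
For a finite group this is equivalent to all Sylow subgroups being cyclic; unlike that condition it
restricts to subgroups at once and passes to quotients by normal Hall subgroups by lifting elements.
\<close>
definition has_prime_power_orders :: "('a, 'b) monoid_scheme \<Rightarrow> bool" where
  "has_prime_power_orders G \<longleftrightarrow> (\<forall>H p j. subgroup H G \<longrightarrow> Factorial_Ring.prime p \<longrightarrow>
     p ^ j dvd card H \<longrightarrow> (\<exists>u\<in>H. group.ord G u = p ^ j))"

context group
begin

text \<open>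
Outer induction on the order of the subgroup, which handles the proper centralizers, and inner
induction on \<open>k\<close>: the largest prime of \<open>k\<close> is moved, with its full power, from \<open>k\<close> to \<open>m\<close>,
the count is known for the larger exponent, and \<open>card_roots_descend\<close> brings it back.
\<close>
lemma card_roots_large_primes:
  assumes fin: "finite (carrier G)" and orders: "has_prime_power_orders G"
  shows "subgroup H G \<Longrightarrow> card H = k * m \<Longrightarrow>
    (\<And>p q. Factorial_Ring.prime p \<Longrightarrow> Factorial_Ring.prime q \<Longrightarrow> p dvd k \<Longrightarrow> q dvd m \<Longrightarrow> p < q) \<Longrightarrow>
    card (roots H m) = m"
proof (induction "card H" arbitrary: H k m rule: less_induct)
  case (less H)
  note H = less.prems(1) and outer = less.hyps
  have finH: "finite H" using fin subgroup.subset[OF H] finite_subset by blast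
  have cH: "card H > 0" using finH subgroup.one_closed[OF H] card_gt_0_iff by blast
  have "card H = k * m \<Longrightarrow>
    (\<And>p q. Factorial_Ring.prime p \<Longrightarrow> Factorial_Ring.prime q \<Longrightarrow> p dvd k \<Longrightarrow> q dvd m \<Longrightarrow> p < q) \<Longrightarrow>
    card (roots H m) = m" for k m
  proof (induction k arbitrary: m rule: less_induct)
    case (less k)
    note km = less.prems(1) and sep = less.prems(2)
    have pos: "k > 0" "m > 0" using km cH by auto
    show ?case
    proof (cases "k = 1")
      case True
      then have "roots H m = H"
        using km ord_dvd_card_subgroup[OF H] subgroup.mem_carrier[OF H]
        by (auto simp: roots_def pow_eq_id)
      then show ?thesis using km True by simp
    next
      case False
      define p where "p = Max (prime_factors k)"
      have "prime_factors k \<noteq> {}"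
        using False pos prime_factor_nat[of k] by (auto simp: prime_factors_dvd)
      then have "p \<in> prime_factors k" unfolding p_def by (intro Max_in) auto
      then have p: "Factorial_Ring.prime p" "p dvd k" by (auto simp: prime_factors_dvd)
      have p_max: "r \<le> p" if "Factorial_Ring.prime r" "r dvd k" for r
        unfolding p_def using that pos by (intro Max_ge) (auto simp: prime_factors_dvd)
      obtain k' where k': "k = p ^ multiplicity p k * k'" "\<not> p dvd k'"
        using multiplicity_decompose'[of k p] pos prime_gt_1_nat[OF p(1)] by auto
      define a where "a = multiplicity p k"
      have a: "a > 0" using k' p(2) by (cases "a = 0") (auto simp: a_def)
      have k_eq: "k = p ^ a * k'" using k' by (simp add: a_def)
      have "k' > 0" using k_eq pos by (cases "k' = 0") auto
      have "p ^ a > 1" using one_less_power[OF prime_gt_1_nat[OF p(1)] a] .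
      then have "k' < k" unfolding k_eq using \<open>k' > 0\<close> by simp
      \<comment> \<open>Because \<open>p\<close> is the largest prime of \<open>k\<close>, the primes of \<open>k'\<close> are again below those of \<open>p^a m\<close>.\<close>
      have M: "card (roots H (p ^ a * m)) = p ^ a * m"
      proof (rule less.IH[OF \<open>k' < k\<close>])
        show "card H = k' * (p ^ a * m)" using km k_eq by simp
        fix r q assume r: "Factorial_Ring.prime r" "r dvd k'"
          and q: "Factorial_Ring.prime q" "q dvd p ^ a * m"
        have rk: "r dvd k" using r k_eq by simp
        have "r < p" using p_max[OF r(1) rk] r k'(2) by (cases "r = p") auto
        show "r < q"
        proof (cases "q dvd m")
          case False
          then have "q dvd p" using q by (metis prime_dvd_mult_iff prime_dvd_power)
          then show ?thesis using q p \<open>r < p\<close> primes_dvd_imp_eq by blast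
        qed (use sep r q rk in blast)
      qed
      show ?thesis
      proof (rule card_roots_descend[OF fin H p(1) _ pos(2) _ _ M])
        show "\<exists>u\<in>H. ord u = p ^ j" if "j \<le> a" for j
        proof -
          have "p ^ j dvd card H" using that km k_eq by (simp add: le_imp_power_dvd)
          then show ?thesis using orders H p(1) by (auto simp: has_prime_power_orders_def)
        qed
        show "m dvd card H" using km by simp
        show "p < q" if "Factorial_Ring.prime q" "q dvd m" for q using sep that p by blast
        fix u assume u: "u \<in> H" and nc: "cent H u \<noteq> H"
        let ?C = "cent H u"
        have C: "subgroup ?C G" using subgroup_cent[OF H] subgroup.mem_carrier[OF H u] .
        have "?C \<subset> H" using nc by (auto simp: cent_def)
        then have less: "card ?C < card H" using finH psubset_card_mono by blast
        have "card ?C dvd k * m"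
          using card_conj_class[OF H finH subgroup.mem_carrier[OF H u]] km by (metis dvd_triv_right)
        then obtain k1 m1 where C_eq: "card ?C = k1 * m1" and d: "k1 dvd k" "m1 dvd m"
          using division_decomp[of "card ?C" k m] by auto
        have "card (roots ?C m1) = m1"
        proof (rule outer[OF less C C_eq])
          fix r q assume "Factorial_Ring.prime r" "Factorial_Ring.prime q" "r dvd k1" "q dvd m1"
          then show "r < q" using sep d dvd_trans by blast
        qed
        moreover have "gcd m (card ?C) = m1"
        proof -
          have "coprime m k1"
          proof (rule ccontr)
            assume "\<not> coprime m k1"
            then obtain r where "Factorial_Ring.prime r" "r dvd m" "r dvd k1"
              by (rule obtain_common_prime_factor)
            then show False using sep[of r r] d(1) dvd_trans by blast
          qed
          then have "gcd m (k1 * m1) = gcd m m1" by (rule gcd_mult_right_left_cancel)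
          then show ?thesis using C_eq d(2) by (simp add: gcd_nat.absorb2)
        qed
        ultimately show "card (roots ?C m) = gcd m (card ?C)"
          using roots_gcd[OF C, of m] by simp
      qed
    qed
  qed
  then show ?case using less.prems(2,3) by blast
qed


section \<open>Elements of prime power order in Z-groups\<close>

lemma conj_image:
  assumes P: "subgroup P G" and g: "g \<in> carrier G"
  shows "subgroup ((\<lambda>x. g \<otimes> x \<otimes> inv g) ` P) G"
    and "card ((\<lambda>x. g \<otimes> x \<otimes> inv g) ` P) = card P"
proof -
  have Pc: "x \<in> P \<Longrightarrow> x \<in> carrier G" for x using subgroup.mem_carrier[OF P] .
  show "subgroup ((\<lambda>x. g \<otimes> x \<otimes> inv g) ` P) G"
  proof (rule subgroupI)
    show "(\<lambda>x. g \<otimes> x \<otimes> inv g) ` P \<subseteq> carrier G" using g Pc by auto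
    show "(\<lambda>x. g \<otimes> x \<otimes> inv g) ` P \<noteq> {}" using subgroup.one_closed[OF P] by auto
  next
    fix a assume "a \<in> (\<lambda>x. g \<otimes> x \<otimes> inv g) ` P"
    then obtain x where x: "x \<in> P" "a = g \<otimes> x \<otimes> inv g" by auto
    have "inv a = g \<otimes> inv x \<otimes> inv g" using x g Pc by (simp add: inv_mult_group m_assoc)
    then show "inv a \<in> (\<lambda>x. g \<otimes> x \<otimes> inv g) ` P" using x subgroup.m_inv_closed[OF P] by auto
  next
    fix a b assume "a \<in> (\<lambda>x. g \<otimes> x \<otimes> inv g) ` P" "b \<in> (\<lambda>x. g \<otimes> x \<otimes> inv g) ` P"
    then obtain x y where x: "x \<in> P" "a = g \<otimes> x \<otimes> inv g" and y: "y \<in> P" "b = g \<otimes> y \<otimes> inv g" by auto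
    have "a \<otimes> b = g \<otimes> x \<otimes> (inv g \<otimes> g) \<otimes> y \<otimes> inv g"
      unfolding x(2) y(2) using x(1) y(1) g Pc by (simp only: m_assoc inv_closed m_closed)
    also have "\<dots> = g \<otimes> (x \<otimes> y) \<otimes> inv g" using x(1) y(1) g Pc by (simp add: m_assoc)
    finally show "a \<otimes> b \<in> (\<lambda>x. g \<otimes> x \<otimes> inv g) ` P" using x y subgroup.m_closed[OF P] by auto
  qed
  have "inj_on (\<lambda>x. g \<otimes> x \<otimes> inv g) P"
    using g Pc by (auto intro!: inj_onI)
  then show "card ((\<lambda>x. g \<otimes> x \<otimes> inv g) ` P) = card P" by (rule card_image)
qed

definition double_coset :: "'a set \<Rightarrow> 'a set \<Rightarrow> 'a \<Rightarrow> 'a set" where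
  "double_coset H P g = (\<lambda>(h, x). h \<otimes> g \<otimes> x) ` (H \<times> P)"

lemma double_coset_self:
  assumes "subgroup H G" "subgroup P G" "g \<in> carrier G"
  shows "g \<in> double_coset H P g"
  unfolding double_coset_def
  by (rule image_eqI[of _ _ "(\<one>, \<one>)"]) (use assms in \<open>auto simp: subgroup.one_closed\<close>)

lemma double_coset_eq:
  assumes H: "subgroup H G" and P: "subgroup P G" and g: "g \<in> carrier G"
    and y: "y \<in> double_coset H P g"
  shows "double_coset H P y = double_coset H P g"
proof -
  note Hc = subgroup.mem_carrier[OF H] and Pc = subgroup.mem_carrier[OF P]
  have sub: "double_coset H P (h \<otimes> g \<otimes> x) \<subseteq> double_coset H P g"
    if h: "h \<in> H" and x: "x \<in> P" and g: "g \<in> carrier G" for h x g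
  proof
    fix z assume "z \<in> double_coset H P (h \<otimes> g \<otimes> x)"
    then obtain a b where ab: "a \<in> H" "b \<in> P" "z = a \<otimes> (h \<otimes> g \<otimes> x) \<otimes> b"
      by (auto simp: double_coset_def)
    then have "z = (a \<otimes> h) \<otimes> g \<otimes> (x \<otimes> b)" using h x g Hc Pc by (simp add: m_assoc)
    then show "z \<in> double_coset H P g"
      unfolding double_coset_def
      by (intro image_eqI[of _ _ "(a \<otimes> h, x \<otimes> b)"])
        (use ab h x H P in \<open>auto simp: subgroup.m_closed\<close>)
  qed
  obtain h x where hx: "h \<in> H" "x \<in> P" "y = h \<otimes> g \<otimes> x" using y by (auto simp: double_coset_def)
  have yc: "y \<in> carrier G" using hx g Hc Pc by simp
  have "inv h \<otimes> y \<otimes> inv x = (inv h \<otimes> h) \<otimes> g \<otimes> (x \<otimes> inv x)"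
    unfolding hx(3) using hx(1,2) g Hc Pc by (simp only: m_assoc inv_closed m_closed)
  then have "g = inv h \<otimes> y \<otimes> inv x" using hx(1,2) g Hc Pc by simp
  then have "double_coset H P g \<subseteq> double_coset H P y"
    using sub[of "inv h" "inv x" y] hx(1,2) yc H P by (simp add: subgroup.m_inv_closed)
  then show ?thesis using sub[OF hx(1,2) g] hx(3) by blast
qed

text \<open>
The map \<open>(h, x) \<mapsto> h g x\<close> sends \<open>H \<times> P\<close> onto the double coset, and the pairs with the same
value as \<open>(h, x)\<close> are the pairs \<open>(h t^(-1), g^(-1) t g x)\<close> with \<open>t\<close> in the intersection.
\<close>
lemma card_double_coset:
  assumes H: "subgroup H G" and P: "subgroup P G" and g: "g \<in> carrier G"
    and fin: "finite H" "finite P"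
  shows "card (double_coset H P g) * card (H \<inter> (\<lambda>x. g \<otimes> x \<otimes> inv g) ` P) = card H * card P"
proof -
  note Hc = subgroup.mem_carrier[OF H] and Pc = subgroup.mem_carrier[OF P]
  let ?f = "\<lambda>(h, x). h \<otimes> g \<otimes> x" and ?S = "H \<inter> (\<lambda>x. g \<otimes> x \<otimes> inv g) ` P"
  have fib: "card {z \<in> H \<times> P. ?f z = w} = card ?S" if w: "w \<in> double_coset H P g" for w
  proof -
    obtain h x where hx: "h \<in> H" "x \<in> P" "w = h \<otimes> g \<otimes> x" using w by (auto simp: double_coset_def)
    note c = Hc[OF hx(1)] Pc[OF hx(2)] g
    have "bij_betw (\<lambda>t. (h \<otimes> inv t, inv g \<otimes> t \<otimes> g \<otimes> x)) ?S {z \<in> H \<times> P. ?f z = w}"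
    proof (rule bij_betw_byWitness[where f' = "\<lambda>(a, b). inv a \<otimes> h"])
      show "\<forall>t\<in>?S. (\<lambda>(a, b). inv a \<otimes> h) (h \<otimes> inv t, inv g \<otimes> t \<otimes> g \<otimes> x) = t"
        using Hc c by (auto simp: inv_mult_group m_assoc)
      show "\<forall>z\<in>{z \<in> H \<times> P. ?f z = w}. (\<lambda>t. (h \<otimes> inv t, inv g \<otimes> t \<otimes> g \<otimes> x)) ((\<lambda>(a, b). inv a \<otimes> h) z) = z"
      proof (rule ballI)
        fix z assume z: "z \<in> {z \<in> H \<times> P. ?f z = w}"
        obtain a b where zab: "z = (a, b)" by (cases z)
        with z have ab: "a \<in> H" "b \<in> P" "a \<otimes> g \<otimes> b = w" by auto
        note abc = Hc[OF ab(1)] Pc[OF ab(2)]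
        have "h \<otimes> inv (inv a \<otimes> h) = a"
          using abc c by (simp add: inv_mult_group m_assoc[symmetric])
        moreover have "inv g \<otimes> (inv a \<otimes> h) \<otimes> g \<otimes> x = inv g \<otimes> inv a \<otimes> (a \<otimes> g \<otimes> b)"
          unfolding ab(3) hx(3) using abc c by (simp add: m_assoc)
        then have "inv g \<otimes> (inv a \<otimes> h) \<otimes> g \<otimes> x = b"
          using abc c by (simp add: m_assoc inv_solve_left')
        ultimately show "(\<lambda>t. (h \<otimes> inv t, inv g \<otimes> t \<otimes> g \<otimes> x)) ((\<lambda>(a, b). inv a \<otimes> h) z) = z"
          by (simp add: zab)
      qed
      show "(\<lambda>t. (h \<otimes> inv t, inv g \<otimes> t \<otimes> g \<otimes> x)) ` ?S \<subseteq> {z \<in> H \<times> P. ?f z = w}"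
      proof (rule image_subsetI)
        fix t assume t: "t \<in> ?S"
        then obtain y where y: "y \<in> P" "t = g \<otimes> y \<otimes> inv g" by auto
        have tc: "t \<in> carrier G" "t \<in> H" using t Hc by auto
        have e: "inv g \<otimes> t \<otimes> g = y"
          unfolding y(2) using Pc[OF y(1)] g by (metis inv_closed inv_solve_left' inv_solve_right' m_assoc m_closed)
        have "h \<otimes> inv t \<otimes> g \<otimes> (inv g \<otimes> t \<otimes> g \<otimes> x) = h \<otimes> (inv t \<otimes> (g \<otimes> inv g) \<otimes> t) \<otimes> g \<otimes> x"
          using tc c by (simp only: m_assoc inv_closed m_closed)
        also have "\<dots> = w" using tc c hx by simp
        finally show "(h \<otimes> inv t, inv g \<otimes> t \<otimes> g \<otimes> x) \<in> {z \<in> H \<times> P. ?f z = w}"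
          unfolding e using tc hx y H P by (simp add: subgroup.m_closed subgroup.m_inv_closed)
      qed
      show "(\<lambda>(a, b). inv a \<otimes> h) ` {z \<in> H \<times> P. ?f z = w} \<subseteq> ?S"
      proof (rule image_subsetI)
        fix z assume z: "z \<in> {z \<in> H \<times> P. ?f z = w}"
        obtain a b where zab: "z = (a, b)" by (cases z)
        with z have ab: "a \<in> H" "b \<in> P" "a \<otimes> g \<otimes> b = w" by auto
        note abc = Hc[OF ab(1)] Pc[OF ab(2)]
        have "inv a \<otimes> h = inv a \<otimes> (h \<otimes> g \<otimes> x) \<otimes> inv x \<otimes> inv g"
          using abc c by (simp add: m_assoc)
        also have "\<dots> = inv a \<otimes> (a \<otimes> g \<otimes> b) \<otimes> inv x \<otimes> inv g"
          using ab(3) hx(3) by simp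
        also have "\<dots> = (inv a \<otimes> a) \<otimes> g \<otimes> (b \<otimes> inv x) \<otimes> inv g"
          using abc c by (simp only: m_assoc inv_closed m_closed)
        also have "\<dots> = g \<otimes> (b \<otimes> inv x) \<otimes> inv g" using abc c by simp
        finally have "inv a \<otimes> h = g \<otimes> (b \<otimes> inv x) \<otimes> inv g" .
        moreover have "b \<otimes> inv x \<in> P" "inv a \<otimes> h \<in> H"
          using ab hx H P by (simp_all add: subgroup.m_closed subgroup.m_inv_closed)
        ultimately show "(\<lambda>(a, b). inv a \<otimes> h) z \<in> ?S"
          by (auto simp: zab)
      qed
    qed
    then show ?thesis by (rule bij_betw_same_card[symmetric])
  qed
  have "card (H \<times> P) = (\<Sum>w\<in>double_coset H P g. card {z \<in> H \<times> P. ?f z = w})"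
    using sum.group[of "H \<times> P" "double_coset H P g" ?f "\<lambda>_. 1::nat"] fin
    by (simp add: double_coset_def)
  then show ?thesis using fib by (simp add: card_cartesian_product)
qed

lemma cyclic_subgroup_generator:
  assumes Q: "subgroup Q G" and cyc: "cyclic_group (G\<lparr>carrier := Q\<rparr>)"
  obtains c where "c \<in> Q" "generate G {c} = Q"
proof -
  interpret Q: group "G\<lparr>carrier := Q\<rparr>" using subgroup_imp_group[OF Q] .
  obtain c where c: "c \<in> Q" "Q = range (\<lambda>n::int. c [^]\<^bsub>G\<lparr>carrier := Q\<rparr>\<^esub> n)"
    using cyc by (auto simp: Q.cyclic_group)
  have "generate G {c} = range (\<lambda>n::int. c [^] n)"
    using generate_pow[OF subgroup.mem_carrier[OF Q c(1)]] by auto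
  also have "\<dots> = Q" using c int_pow_consistent[OF Q c(1)] by simp
  finally show ?thesis using c that by blast
qed

text \<open>
If all elements of \<open>S\<close> had order dividing \<open>p^(i - 1)\<close>, then \<open>S\<close> would lie in the subgroup of
order \<open>p^(i - 1)\<close> of the cyclic group, which is too small.
\<close>
lemma subgroup_of_cyclic_prime_power:
  assumes fin: "finite (carrier G)" and c: "c \<in> carrier G" "ord c = p ^ a" and p: "Factorial_Ring.prime p"
    and S: "subgroup S G" "S \<subseteq> generate G {c}" "card S = p ^ i"
  shows "\<exists>x\<in>S. ord x = p ^ i"
proof (rule ccontr)
  assume no: "\<not> (\<exists>x\<in>S. ord x = p ^ i)"
  have p1: "p > 1" using prime_gt_1_nat[OF p] .
  have "i \<noteq> 0"
    using no subgroup.one_closed[OF S(1)] by (metis ord_id power_0)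
  have "card S dvd p ^ a"
  proof -
    have "card S \<le> p ^ a"
      using S(2) generate_pow_card[OF c(1)] c(2) fin
      by (metis card_mono generate_incl[of "{c}"] empty_subsetI insert_subset c(1) finite_subset)
    then have "i \<le> a" using S(3) p1 by (simp add: power_increasing_iff)
    then show ?thesis using S(3) by (simp add: le_imp_power_dvd)
  qed
  then have ia: "i \<le> a" using S(3) p1 by (simp add: power_dvd_imp_le)
  define e where "e = a - i + 1"
  have a_eq: "p ^ a = p ^ e * p ^ (i - 1)"
  proof -
    have "a = e + (i - 1)" using ia \<open>i \<noteq> 0\<close> by (simp add: e_def)
    then show ?thesis by (metis power_add)
  qed
  have ord_e: "ord (c [^] (p ^ e)) = p ^ (i - 1)"
    using ord_pow[OF c(1), of "p ^ e"] p1 a_eq c(2) by simp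
  have "S \<subseteq> generate G {c [^] (p ^ e)}"
  proof
    fix x assume x: "x \<in> S"
    then obtain k :: nat where k: "x = c [^] k"
      using S(2) generate_pow_on_finite_carrier[OF fin c(1)] by auto
    have "ord x dvd p ^ i" using ord_dvd_card_subgroup[OF S(1) x] S(3) by simp
    then obtain j where j: "j \<le> i" "ord x = p ^ j" using p divides_primepow_nat by blast
    then have "j \<le> i - 1" using no x by (cases "j = i") auto
    then have "ord x dvd p ^ (i - 1)" using j by (simp add: le_imp_power_dvd)
    then have "c [^] (k * p ^ (i - 1)) = \<one>"
      using pow_eq_id[of x] c(1) k by (simp add: nat_pow_pow)
    then have "p ^ e * p ^ (i - 1) dvd k * p ^ (i - 1)"
      using pow_eq_id[OF c(1)] c(2) a_eq by simp
    then have "p ^ e dvd k" using p1 by simp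
    then obtain l where "k = p ^ e * l" by (auto elim: dvdE)
    then have "x = (c [^] (p ^ e)) [^] l" using k c(1) by (simp add: nat_pow_pow)
    then show "x \<in> generate G {c [^] (p ^ e)}"
      using generate_pow_on_finite_carrier[OF fin, of "c [^] (p ^ e)"] c(1) by auto
  qed
  then have "card S \<le> card (generate G {c [^] (p ^ e)})"
    using fin c(1) generate_incl[of "{c [^] (p ^ e)}"] by (intro card_mono) (auto intro: finite_subset)
  also have "\<dots> = p ^ (i - 1)"
    using generate_pow_card[of "c [^] (p ^ e)"] c(1) ord_e by simp
  also have "\<dots> < p ^ i" using p1 \<open>i \<noteq> 0\<close> by simp
  finally show False using S(3) by simp
qed

end

lemma (in group) card_subgroup_dvd:
  assumes I: "subgroup I G" and J: "subgroup J G" and "I \<subseteq> J"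
  shows "card I dvd card J"
proof -
  interpret J: group "G\<lparr>carrier := J\<rparr>" using subgroup_imp_group[OF J] .
  have "card I dvd order (G\<lparr>carrier := J\<rparr>)"
    using J.lagrange[OF subgroup_incl[OF assms]] by (metis dvd_triv_right)
  then show ?thesis by (simp add: order_def)
qed

text \<open>
Let \<open>P\<close> be a Sylow \<open>p\<close>-subgroup of \<open>G\<close>.  Since the double cosets \<open>H g P\<close> partition \<open>G\<close>, one of
them has size not divisible by \<open>p |P|\<close>, and then the intersection of \<open>H\<close> with the conjugate of \<open>P\<close> by
\<open>g\<close> contains the full power of \<open>p\<close> dividing \<open>|H|\<close>.  That conjugate is also a Sylow subgroup, so the
intersection is a subgroup of a cyclic \<open>p\<close>-group and contains an element of the largest
possible order, whose powers have all smaller orders.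
\<close>
lemma Z_group_has_prime_power_orders:
  fixes G (structure)
  assumes fin: "finite (carrier G)" and Z: "Z_group G"
  shows "has_prime_power_orders G"
proof -
  interpret group G using Z by (simp add: Z_group_def)
  show ?thesis
    unfolding has_prime_power_orders_def
  proof (intro allI impI)
    fix H p j assume H: "subgroup H G" and p: "Factorial_Ring.prime p" and j: "p ^ j dvd card H"
    have p1: "p > 1" using prime_gt_1_nat[OF p] .
    have finS: "finite S" if "subgroup S G" for S
      using that fin subgroup.subset finite_subset by blast
    have posS: "card S > 0" if "subgroup S G" for S
      using finS[OF that] subgroup.one_closed[OF that] card_gt_0_iff by blast
    define a where "a = multiplicity p (order G)"
    define b where "b = multiplicity p (card H)"
    have ord_pos: "order G > 0" using fin order_gt_0_iff_finite by blast
    have "p ^ a dvd order G" unfolding a_def by (rule multiplicity_dvd)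
    then have "order G = p ^ a * (order G div p ^ a)" by simp
    then obtain P where P: "subgroup P G" "card P = p ^ a"
      using sylow_thm[OF p is_group _ fin] by blast

    have "\<exists>g\<in>carrier G. \<not> p ^ Suc a dvd card (double_coset H P g)"
    proof (rule ccontr)
      assume "\<not> ?thesis"
      then have all: "p ^ Suc a dvd card (double_coset H P g)" if "g \<in> carrier G" for g
        using that by blast
      have "p ^ Suc a dvd (\<Sum>x\<in>carrier G. 1)"
      proof (rule dvd_sum_fibres[where g = "double_coset H P"])
        fix g assume g: "g \<in> carrier G"
        have "double_coset H P g \<subseteq> carrier G"
          using g subgroup.mem_carrier[OF H] subgroup.mem_carrier[OF P(1)]
          by (auto simp: double_coset_def)
        then have "{y \<in> carrier G. double_coset H P y = double_coset H P g} = double_coset H P g"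
          using double_coset_self[OF H P(1)] double_coset_eq[OF H P(1) g] by blast
        then show "p ^ Suc a dvd (\<Sum>y\<in>{y \<in> carrier G. double_coset H P y = double_coset H P g}. 1)"
          using all[OF g] by simp
      qed (rule fin)
      then have "p ^ Suc a dvd order G" by (simp add: order_def)
      then have "Suc a \<le> multiplicity p (order G)"
        using ord_pos p by (intro multiplicity_geI) auto
      then show False by (simp add: a_def)
    qed
    then obtain g where g: "g \<in> carrier G" and nd: "\<not> p ^ Suc a dvd card (double_coset H P g)"
      by blast
    define Q where "Q = (\<lambda>x. g \<otimes> x \<otimes> inv g) ` P"
    have Q: "subgroup Q G" "card Q = p ^ a"
      using conj_image[OF P(1) g] P(2) by (simp_all add: Q_def)
    have S: "subgroup (H \<inter> Q) G" using subgroups_Inter_pair[OF H Q(1)] .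
    have "cyclic_group (G\<lparr>carrier := Q\<rparr>)"
      using Z p Q by (auto simp: Z_group_def sylow_subgroup_def a_def)
    then obtain c where c: "c \<in> Q" "generate G {c} = Q"
      by (rule cyclic_subgroup_generator[OF Q(1)])
    have cc: "c \<in> carrier G" using subgroup.mem_carrier[OF Q(1) c(1)] .
    have "card (H \<inter> Q) dvd p ^ a" using card_subgroup_dvd[OF S Q(1)] Q(2) by auto
    then obtain i where i: "card (H \<inter> Q) = p ^ i" using p divides_primepow_nat by blast
    have eq: "card (double_coset H P g) * p ^ i = card H * p ^ a"
      using card_double_coset[OF H P(1) g finS[OF H] finS[OF P(1)]] i P(2) by (simp add: Q_def)
    have "b \<le> i"
    proof (rule ccontr)
      assume "\<not> b \<le> i"
      then have "p ^ (Suc a + i) dvd p ^ (b + a)" by (intro le_imp_power_dvd) simp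
      also have "p ^ (b + a) dvd card H * p ^ a"
        using multiplicity_dvd[of p "card H"] by (simp add: b_def power_add mult_dvd_mono)
      finally have "p ^ Suc a * p ^ i dvd card (double_coset H P g) * p ^ i"
        using eq by (simp add: power_add)
      then show False using nd p1 by simp
    qed
    have "j \<le> b" unfolding b_def using j posS[OF H] p by (intro multiplicity_geI) auto
    with \<open>b \<le> i\<close> have ji: "j \<le> i" by simp
    obtain x where x: "x \<in> H \<inter> Q" "ord x = p ^ i"
      using subgroup_of_cyclic_prime_power[OF fin cc _ p S _ i, of a] c Q(2) generate_pow_card[OF cc]
      by auto
    have xc: "x \<in> carrier G" using x subgroup.mem_carrier[OF H] by auto
    have pow_split: "p ^ i = p ^ j * p ^ (i - j)" using ji by (simp flip: power_add)
    then have "ord (x [^] (p ^ (i - j))) = p ^ j"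
      using ord_pow[OF xc, of "p ^ (i - j)"] x(2) p1 by simp
    then show "\<exists>u\<in>H. ord u = p ^ j"
      using subgroup_pow_closed[OF H, of x] x by blast
  qed
qed

section \<open>The derived subgroup of a Z-group is abelian\<close>

text \<open>
For the largest prime \<open>q\<close> dividing \<open>|G|\<close>, with full power \<open>q^a\<close>, the equation \<open>x^(q^a) = 1\<close>
has only \<open>q^a\<close> solutions.  A Sylow \<open>q\<close>-subgroup consists of solutions, so it is the set of all of them,
and that set is invariant under conjugation.
\<close>
lemma (in group) exists_normal_sylow:
  assumes fin: "finite (carrier G)" and orders: "has_prime_power_orders G" and nontriv: "order G > 1"
  obtains q a k Q u where "Factorial_Ring.prime q" "a > 0" "order G = k * q ^ a" "coprime k q"
    "Q \<lhd> G" "card Q = q ^ a" "u \<in> Q" "generate G {u} = Q"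
proof -
  define q where "q = Max (prime_factors (order G))"
  have "prime_factors (order G) \<noteq> {}"
    using nontriv prime_factor_nat[of "order G"] by (auto simp: prime_factors_dvd)
  then have "q \<in> prime_factors (order G)" unfolding q_def by (intro Max_in) auto
  then have q: "Factorial_Ring.prime q" "q dvd order G" by (auto simp: prime_factors_dvd)
  have q_max: "r \<le> q" if "Factorial_Ring.prime r" "r dvd order G" for r
    unfolding q_def using that nontriv by (intro Max_ge) (auto simp: prime_factors_dvd)
  obtain k where k: "order G = q ^ multiplicity q (order G) * k" "\<not> q dvd k"
    using multiplicity_decompose'[of "order G" q] nontriv prime_gt_1_nat[OF q(1)] by auto
  define a where "a = multiplicity q (order G)"
  have k_eq: "order G = k * q ^ a" using k by (simp add: a_def mult.commute)
  have a: "a > 0" using k q(2) by (cases "a = 0") (auto simp: a_def)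
  have cop: "coprime k q" using prime_imp_coprime[OF q(1) k(2)] coprime_commute by blast
  have card_Q: "card (roots (carrier G) (q ^ a)) = q ^ a"
  proof (rule card_roots_large_primes[OF fin orders subgroup_self, of k])
    show "card (carrier G) = k * q ^ a" using k_eq by (simp add: order_def)
    fix r s assume r: "Factorial_Ring.prime r" "r dvd k" and s: "Factorial_Ring.prime s" "s dvd q ^ a"
    have "s = q" using s q(1) prime_dvd_power primes_dvd_imp_eq by blast
    moreover have "r \<le> q" using q_max[OF r(1)] r(2) k_eq by simp
    moreover have "r \<noteq> q" using r k(2) by auto
    ultimately show "r < s" by simp
  qed
  obtain Q where Q: "subgroup Q G" "card Q = q ^ a"
    using sylow_thm[OF q(1) is_group, of a k] k_eq fin by (auto simp: mult.commute)
  have "Q \<subseteq> roots (carrier G) (q ^ a)"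
    using ord_dvd_card_subgroup[OF Q(1)] Q(2) subgroup.mem_carrier[OF Q(1)]
    by (auto simp: roots_def pow_eq_id)
  moreover have "finite (roots (carrier G) (q ^ a))" using fin roots_subset finite_subset by blast
  ultimately have Q_eq: "Q = roots (carrier G) (q ^ a)"
    using card_Q Q(2) by (metis card_subset_eq)
  have normal: "Q \<lhd> G"
    unfolding normal_inv_iff using Q(1) conj_pow by (auto simp: Q_eq roots_def)
  obtain u where u: "u \<in> Q" "ord u = q ^ a"
    using orders Q q(1) unfolding has_prime_power_orders_def by (metis dvd_refl)
  have uc: "u \<in> carrier G" using subgroup.mem_carrier[OF Q(1) u(1)] .
  have "generate G {u} = Q"
  proof (rule card_subset_eq)
    show "finite Q" using Q(1) fin subgroup.subset finite_subset by blast
    show "generate G {u} \<subseteq> Q" using generate_subgroup_incl[of "{u}" Q] u Q by simp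
    show "card (generate G {u}) = card Q" using generate_pow_card[OF uc] u Q by simp
  qed
  then show ?thesis using that q(1) a k_eq cop normal Q(2) u(1) by blast
qed

lemma (in normal) card_union_FactGroup:
  assumes fin: "finite (carrier G)" and K: "subgroup K (G Mod H)"
  shows "card (\<Union>K) = card H * card K"
proof -
  have Ks: "K \<subseteq> rcosets H" using subgroup.subset[OF K] by (simp add: FactGroup_def)
  have part: "\<Union>(rcosets H) = carrier G" using rcosets_part_G is_subgroup by blast
  have "card H * card K = card (\<Union>K)"
  proof (rule card_partition)
    have "finite (rcosets H)" using part fin finite_UnionD by metis
    then show "finite K" using Ks finite_subset by blast
    show "finite (\<Union>K)" using Ks part fin by (metis Union_mono finite_subset)
    show "card c = card H" if "c \<in> K" for c
      using card_rcosets_equal[of c H] that Ks subset by auto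
    show "c1 \<inter> c2 = {}" if "c1 \<in> K" "c2 \<in> K" "c1 \<noteq> c2" for c1 c2
      using rcos_disjoint[OF is_subgroup] that Ks by (auto simp: pairwise_def disjnt_def)
  qed
  then show ?thesis by simp
qed

text \<open>
A prime power dividing the order of a subgroup of the quotient divides the order of its preimage.
An element \<open>u\<close> of that order in the preimage keeps its order in the quotient, since \<open>H\<close>
meets the subgroup generated by \<open>u\<close> trivially, the orders being coprime.
\<close>
lemma (in normal) has_prime_power_orders_FactGroup:
  assumes fin: "finite (carrier G)" and orders: "has_prime_power_orders G"
    and cop: "coprime (card H) (order (G Mod H))"
  shows "has_prime_power_orders (G Mod H)"
  unfolding has_prime_power_orders_def
proof (intro allI impI)
  interpret F: group "G Mod H" by (rule factorgroup_is_group)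
  fix K p j assume K: "subgroup K (G Mod H)" and p: "Factorial_Ring.prime p" and j: "p ^ j dvd card K"
  have "card K dvd order (G Mod H)"
    using F.lagrange[OF K] by (metis dvd_triv_right)
  then have cop': "coprime (card H) (p ^ j)"
    using cop j by (meson coprime_divisors dvd_refl dvd_trans)
  have sub: "subgroup (\<Union>K) G" using factgroup_subgroup_union_subgroup[OF K] .
  have "p ^ j dvd card (\<Union>K)" using card_union_FactGroup[OF fin K] j by simp
  then obtain u where u: "u \<in> \<Union>K" "ord u = p ^ j"
    using orders sub p unfolding has_prime_power_orders_def by blast
  then have uc: "u \<in> carrier G" "H #> u \<in> K"
    using factgroup_subgroup_union_char[OF K] by auto
  have "(H #> u) [^]\<^bsub>G Mod H\<^esub> n = \<one>\<^bsub>G Mod H\<^esub> \<longleftrightarrow> p ^ j dvd n" for n :: nat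
  proof -
    have "(H #> u) [^]\<^bsub>G Mod H\<^esub> n = \<one>\<^bsub>G Mod H\<^esub> \<longleftrightarrow> H #> (u [^] n) = H"
      using FactGroup_pow[OF uc(1)] by simp
    also have "\<dots> \<longleftrightarrow> u [^] n \<in> H"
      using uc is_subgroup by (metis coset_join1 coset_join2 nat_pow_closed subset)
    also have "\<dots> \<longleftrightarrow> u [^] n = \<one>"
    proof
      assume un: "u [^] n \<in> H"
      have "ord (u [^] n) dvd card H" using ord_dvd_card_subgroup[OF is_subgroup un] .
      moreover have "ord (u [^] n) dvd p ^ j"
      proof -
        have "(u [^] n) [^] (p ^ j) = (u [^] ord u) [^] n"
          using uc u(2) by (simp add: nat_pow_pow mult.commute)
        then have "(u [^] n) [^] (p ^ j) = \<one>" using uc by simp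
        then show ?thesis using uc pow_eq_id by simp
      qed
      ultimately have "ord (u [^] n) = 1" using cop' coprime_common_divisor_nat by blast
      then show "u [^] n = \<one>" using uc ord_eq_1 by simp
    qed (simp add: one_closed)
    also have "\<dots> \<longleftrightarrow> p ^ j dvd n" using pow_eq_id[OF uc(1)] u(2) by simp
    finally show ?thesis .
  qed
  then have "F.ord (H #> u) = p ^ j"
    using F.ord_unique[of "H #> u" "p ^ j"] subgroup.mem_carrier[OF K uc(2)] by blast
  then show "\<exists>u\<in>K. F.ord u = p ^ j" using uc(2) by blast
qed

context group
begin

lemma inv_cancel_left:
  assumes "x \<in> carrier G" "y \<in> carrier G"
  shows "inv x \<otimes> (x \<otimes> y) = y" "x \<otimes> (inv x \<otimes> y) = y"
  using assms by (simp_all flip: m_assoc)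

text \<open>
The automorphism group of a cyclic group is abelian: conjugation by \<open>a\<close> and by \<open>b\<close> raises the elements
of \<open>Q\<close> to fixed powers, and taking powers commutes.  Hence a commutator acts trivially on \<open>Q\<close>.
\<close>
lemma commutators_centralize_cyclic_normal:
  assumes fin: "finite (carrier G)" and Q: "Q \<lhd> G" and u: "u \<in> Q" "generate G {u} = Q"
    and c: "c \<in> derived_set G (carrier G)" and z: "z \<in> Q"
  shows "c \<otimes> z = z \<otimes> c"
proof -
  have Qs: "subgroup Q G" using Q by (rule normal_imp_subgroup)
  note Qc = subgroup.mem_carrier[OF Qs]
  have uc: "u \<in> carrier G" using Qc u by blast
  have pow: "\<exists>k::nat. y = u [^] k" if "y \<in> Q" for y
    using generate_pow_on_finite_carrier[OF fin uc] u(2) that by auto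
  have conj_in: "g \<otimes> y \<otimes> inv g \<in> Q" if "g \<in> carrier G" "y \<in> Q" for g y
    using normal.inv_op_closed2[OF Q that] .
  obtain a b where ab: "a \<in> carrier G" "b \<in> carrier G" "c = a \<otimes> b \<otimes> inv a \<otimes> inv b"
    using c by auto
  obtain i j :: nat where i: "a \<otimes> u \<otimes> inv a = u [^] i" and j: "b \<otimes> u \<otimes> inv b = u [^] j"
    using pow[OF conj_in[OF ab(1) u(1)]] pow[OF conj_in[OF ab(2) u(1)]] by blast
  have conj_comm: "a \<otimes> (b \<otimes> y \<otimes> inv b) \<otimes> inv a = b \<otimes> (a \<otimes> y \<otimes> inv a) \<otimes> inv b" if y: "y \<in> Q" for y
  proof -
    obtain k :: nat where k: "y = u [^] k" using pow[OF y] by blast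
    have ay: "a \<otimes> u [^] (n::nat) \<otimes> inv a = u [^] (i * n)" for n
      using conj_pow[OF ab(1) uc, of n] i uc by (simp add: nat_pow_pow)
    have bY: "b \<otimes> u [^] (n::nat) \<otimes> inv b = u [^] (j * n)" for n
      using conj_pow[OF ab(2) uc, of n] j uc by (simp add: nat_pow_pow)
    show ?thesis unfolding k ay bY by (simp add: mult.left_commute)
  qed
  \<comment> \<open>Since \<open>c = (a b) (b a)^(-1)\<close>, conjugating \<open>z\<close> by \<open>c\<close> is conjugating \<open>y\<close> by \<open>a b\<close>,
    which is the same as conjugating \<open>y\<close> by \<open>b a\<close> and so gives back \<open>z\<close>.\<close>
  define y where "y = inv (b \<otimes> a) \<otimes> z \<otimes> inv (inv (b \<otimes> a))"
  have yQ: "y \<in> Q" unfolding y_def using conj_in[of "inv (b \<otimes> a)" z] ab z by simp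
  have zc: "z \<in> carrier G" and yc: "y \<in> carrier G" using Qc z yQ by auto
  have cc: "c \<in> carrier G" using ab by simp
  have c_eq: "c \<otimes> (b \<otimes> a) = a \<otimes> b"
    using ab by (simp add: m_assoc inv_cancel_left)
  have z_eq: "z = (b \<otimes> a) \<otimes> y \<otimes> inv (b \<otimes> a)"
    unfolding y_def using ab(1,2) zc by (simp add: m_assoc inv_mult_group inv_cancel_left)
  have "c \<otimes> (x \<otimes> y \<otimes> inv x) \<otimes> inv c = (c \<otimes> x) \<otimes> y \<otimes> inv (c \<otimes> x)" if "x \<in> carrier G" for x
    using cc yc that by (simp add: inv_mult_group m_assoc)
  then have "c \<otimes> z \<otimes> inv c = (c \<otimes> (b \<otimes> a)) \<otimes> y \<otimes> inv (c \<otimes> (b \<otimes> a))"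
    using z_eq ab(1,2) by simp
  also have "\<dots> = a \<otimes> (b \<otimes> y \<otimes> inv b) \<otimes> inv a"
    unfolding c_eq using ab(1,2) yc by (simp add: inv_mult_group m_assoc)
  also have "\<dots> = b \<otimes> (a \<otimes> y \<otimes> inv a) \<otimes> inv b" by (rule conj_comm[OF yQ])
  also have "\<dots> = z"
    using z_eq ab(1,2) yc by (simp add: inv_mult_group m_assoc)
  finally show ?thesis
    using cc zc by (metis inv_closed inv_solve_right m_closed)
qed

text \<open>
With \<open>z = [c, d]\<close> in \<open>Q\<close>, both \<open>c\<close> and \<open>d\<close> commute with \<open>z\<close>, so \<open>[c^n, d] = z^n\<close>.  For \<open>n\<close> the
index of \<open>Q\<close>, the power \<open>c^n\<close> lies in \<open>Q\<close> and therefore commutes with \<open>d\<close>; thus \<open>z^n = 1\<close>, while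
the order of \<open>z\<close> divides \<open>|Q|\<close>, which is coprime to \<open>n\<close>.
\<close>
lemma commuting_modulo_cyclic_hall:
  assumes fin: "finite (carrier G)" and Q: "Q \<lhd> G" and u: "u \<in> Q" "generate G {u} = Q"
    and cop: "coprime (card Q) (order (G Mod Q))"
    and c: "c \<in> derived_set G (carrier G)" and d: "d \<in> derived_set G (carrier G)"
    and mod: "c \<otimes> d \<otimes> inv c \<otimes> inv d \<in> Q"
  shows "c \<otimes> d \<otimes> inv c \<otimes> inv d = \<one>"
proof -
  have Qs: "subgroup Q G" using Q by (rule normal_imp_subgroup)
  interpret F: group "G Mod Q" using normal.factorgroup_is_group[OF Q] .
  note central = commutators_centralize_cyclic_normal[OF fin Q u]
  have cc: "c \<in> carrier G" and dc: "d \<in> carrier G" using c d by auto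
  define z where "z = c \<otimes> d \<otimes> inv c \<otimes> inv d"
  have zQ: "z \<in> Q" using mod by (simp add: z_def)
  have zc: "z \<in> carrier G" using zQ subgroup.mem_carrier[OF Qs] by blast
  have cd: "c \<otimes> d = z \<otimes> (d \<otimes> c)"
    unfolding z_def using cc dc by (simp add: m_assoc inv_cancel_left)
  have step: "c [^] n \<otimes> d = z [^] n \<otimes> (d \<otimes> c [^] n)" for n :: nat
  proof (induction n)
    case (Suc n)
    have zn: "z [^] n \<in> Q" using subgroup_pow_closed[OF Qs zQ] .
    have "c [^] Suc n \<otimes> d = c \<otimes> (c [^] n \<otimes> d)"
      unfolding nat_pow_Suc2[OF cc] using cc dc by (simp only: m_assoc nat_pow_closed)
    also have "\<dots> = (c \<otimes> z [^] n) \<otimes> (d \<otimes> c [^] n)"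
      using Suc cc dc zc by (simp add: m_assoc)
    also have "\<dots> = z [^] n \<otimes> ((c \<otimes> d) \<otimes> c [^] n)"
      unfolding central[OF c zn] using cc dc zc by (simp add: m_assoc)
    also have "\<dots> = (z [^] n \<otimes> z) \<otimes> (d \<otimes> (c \<otimes> c [^] n))"
      unfolding cd using cc dc zc by (simp add: m_assoc)
    also have "c \<otimes> c [^] n = c [^] Suc n" by (rule nat_pow_Suc2[OF cc, symmetric])
    finally show ?case by simp
  qed (use cc dc in simp)
  let ?n = "order (G Mod Q)"
  have "Q #> c \<in> carrier (G Mod Q)" using cc by (auto simp: carrier_FactGroup)
  then have "Q #> (c [^] ?n) = Q"
    using F.pow_order_eq_1[of "Q #> c"] normal.FactGroup_pow[OF Q cc, of ?n] by simp
  then have "c [^] ?n \<in> Q"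
    using coset_join1[of Q "c [^] ?n"] cc Qs subgroup.subset by auto
  then have "c [^] ?n \<otimes> d = d \<otimes> c [^] ?n" using central[OF d] by simp
  then have "z [^] ?n \<otimes> (d \<otimes> c [^] ?n) = d \<otimes> c [^] ?n" using step[of ?n] by simp
  then have "z [^] ?n = \<one>" using cc dc zc by simp
  then have "ord z dvd ?n" using zc pow_eq_id by simp
  moreover have "ord z dvd card Q" using ord_dvd_card_subgroup[OF Qs zQ] .
  ultimately have "ord z = 1" using cop coprime_common_divisor_nat by blast
  then show ?thesis using zc ord_eq_1 by (simp add: z_def)
qed

end

text \<open>
Induction on the index of \<open>N\<close>, for fixed \<open>c\<close> and \<open>d\<close>.  If \<open>N\<close> is not everything, then \<open>G / N\<close> has a
nontrivial normal Sylow subgroup \<open>Q\<close>.  The preimage of \<open>Q\<close> is a larger normal Hall subgroup and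
contains \<open>[c, d]\<close> by induction, so the commutator of the images of \<open>c\<close> and \<open>d\<close> lies in \<open>Q\<close> and is
trivial by \<open>commuting_modulo_cyclic_hall\<close>.  Passing between normal subgroups of one group \<open>G\<close>, rather than
from a group to its quotient, keeps the induction within a single type.
\<close>
lemma (in group) commutators_commute_mod_hall:
  assumes fin: "finite (carrier G)" and orders: "has_prime_power_orders G"
    and c: "c \<in> derived_set G (carrier G)" and d: "d \<in> derived_set G (carrier G)"
  shows "N \<lhd> G \<Longrightarrow> coprime (card N) (order (G Mod N)) \<Longrightarrow> c \<otimes> d \<otimes> inv c \<otimes> inv d \<in> N"
proof (induction "order (G Mod N)" arbitrary: N rule: less_induct)
  case (less N)
  interpret N: normal N G by (rule less.prems(1))
  interpret F: group "G Mod N" by (rule N.factorgroup_is_group)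
  interpret h: group_hom G "G Mod N" "(#>) N"
    by (intro group_hom.intro group_hom_axioms.intro N.r_coset_hom_Mod is_group F.is_group)
  have order_mod: "order (G Mod M) * card M = order G" if "M \<lhd> G" for M
    using lagrange[OF normal_imp_subgroup[OF that]] by (simp add: order_def FactGroup_def)
  have ord_pos: "order G > 0" using fin order_gt_0_iff_finite by blast
  have posF: "order (G Mod N) > 0"
    using order_mod[OF less.prems(1)] ord_pos by (metis gr0I mult_0)
  then have finF: "finite (carrier (G Mod N))" using F.order_gt_0_iff_finite by blast
  have cc: "c \<in> carrier G" and dc: "d \<in> carrier G" using c d by auto
  show ?case
  proof (cases "order (G Mod N) = 1")
    case True
    then have "card N = card (carrier G)"
      using order_mod[OF less.prems(1)] by (simp add: order_def)
    then have "N = carrier G" using fin N.subset card_subset_eq by blast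
    then show ?thesis using cc dc by simp
  next
    case False
    have ordersF: "has_prime_power_orders (G Mod N)"
      using N.has_prime_power_orders_FactGroup[OF fin orders less.prems(2)] .
    have "order (G Mod N) > 1" using False posF by linarith
    then obtain q a k Q u where q: "Factorial_Ring.prime q" "a > 0" "order (G Mod N) = k * q ^ a" "coprime k q"
      and Q: "Q \<lhd> G Mod N" "card Q = q ^ a" "u \<in> Q" "generate (G Mod N) {u} = Q"
      by (rule F.exists_normal_sylow[OF finF ordersF])
    have Qs: "subgroup Q (G Mod N)" using Q(1) by (rule normal_imp_subgroup)
    have qa: "q ^ a > 1" using one_less_power[OF prime_gt_1_nat[OF q(1)] q(2)] .
    have k: "k > 0" using posF q(3) by (cases "k = 0") auto
    have M: "\<Union>Q \<lhd> G" using N.factgroup_subgroup_union_normal[OF Q(1)] .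
    have cardM: "card (\<Union>Q) = card N * q ^ a" using N.card_union_FactGroup[OF fin Qs] Q(2) by simp
    have Npos: "card N > 0" using order_mod[OF less.prems(1)] ord_pos by (cases "card N = 0") auto
    have "order (G Mod \<Union>Q) * (card N * q ^ a) = k * (card N * q ^ a)"
      using order_mod[OF M] order_mod[OF less.prems(1)] cardM q(3) by (simp add: mult_ac)
    then have orderM: "order (G Mod \<Union>Q) = k" using Npos prime_gt_0_nat[OF q(1)] by simp
    have "c \<otimes> d \<otimes> inv c \<otimes> inv d \<in> \<Union>Q"
    proof (rule less.hyps[OF _ M])
      show "order (G Mod \<Union>Q) < order (G Mod N)" using orderM q(3) k qa by simp
      have "coprime (card N) k" using less.prems(2) q(3) by simp
      then show "coprime (card (\<Union>Q)) (order (G Mod \<Union>Q))"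
        using orderM cardM q(4) by (simp add: coprime_commute)
    qed
    then have "N #> (c \<otimes> d \<otimes> inv c \<otimes> inv d) \<in> Q"
      using N.factgroup_subgroup_union_char[OF Qs] by blast
    moreover have image: "N #> (c \<otimes> d \<otimes> inv c \<otimes> inv d)
        = (N #> c) \<otimes>\<^bsub>G Mod N\<^esub> (N #> d) \<otimes>\<^bsub>G Mod N\<^esub> inv\<^bsub>G Mod N\<^esub> (N #> c) \<otimes>\<^bsub>G Mod N\<^esub> inv\<^bsub>G Mod N\<^esub> (N #> d)"
      using cc dc by (simp only: h.hom_mult h.hom_inv m_closed inv_closed)
    have img: "N #> x \<in> derived_set (G Mod N) (carrier (G Mod N))"
      if x: "x \<in> derived_set G (carrier G)" for x
    proof -
      obtain r s where rs: "r \<in> carrier G" "s \<in> carrier G" "x = r \<otimes> s \<otimes> inv r \<otimes> inv s" using x by auto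
      have "N #> x = (N #> r) \<otimes>\<^bsub>G Mod N\<^esub> (N #> s) \<otimes>\<^bsub>G Mod N\<^esub> inv\<^bsub>G Mod N\<^esub> (N #> r) \<otimes>\<^bsub>G Mod N\<^esub> inv\<^bsub>G Mod N\<^esub> (N #> s)"
        unfolding rs(3) using rs(1,2) by (simp only: h.hom_mult h.hom_inv m_closed inv_closed)
      then show ?thesis using h.hom_closed[OF rs(1)] h.hom_closed[OF rs(2)] by blast
    qed
    have "coprime (card Q) (order (G Mod N Mod Q))"
    proof -
      have "order (G Mod N Mod Q) * q ^ a = k * q ^ a"
        using F.lagrange[OF Qs] q(3) Q(2) by (simp add: order_def FactGroup_def)
      then have "order (G Mod N Mod Q) = k" using prime_gt_0_nat[OF q(1)] by simp
      then show ?thesis using Q(2) q(4) by (simp add: coprime_commute)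
    qed
    then have "N #> (c \<otimes> d \<otimes> inv c \<otimes> inv d) = N"
      using F.commuting_modulo_cyclic_hall[OF finF Q(1,3,4) _ img[OF c] img[OF d]] image
        \<open>N #> (c \<otimes> d \<otimes> inv c \<otimes> inv d) \<in> Q\<close> by simp
    then show ?thesis
      using coset_join1[of N] cc dc N.is_subgroup N.subset by simp
  qed
qed

lemma (in group) generate_commuting:
  assumes S: "S \<subseteq> carrier G" and comm: "\<And>x y. x \<in> S \<Longrightarrow> y \<in> S \<Longrightarrow> x \<otimes> y = y \<otimes> x"
    and x: "x \<in> generate G S" and y: "y \<in> generate G S"
  shows "x \<otimes> y = y \<otimes> x"
proof -
  have gen: "generate G S \<subseteq> cent (carrier G) z"
    if z: "z \<in> carrier G" "\<And>s. s \<in> S \<Longrightarrow> s \<otimes> z = z \<otimes> s" for z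
    using generate_subgroup_incl[OF _ subgroup_cent[OF subgroup_self z(1)]] z S
    by (auto simp: cent_def)
  have xc: "x \<in> carrier G" using generate_in_carrier[OF S x] .
  have "s \<otimes> x = x \<otimes> s" if s: "s \<in> S" for s
    using gen[of s] comm s S x by (force simp: cent_def)
  then show ?thesis using gen[OF xc] y by (auto simp: cent_def)
qed

lemma (in group) derived_commuting:
  assumes fin: "finite (carrier G)" and orders: "has_prime_power_orders G"
    and x: "x \<in> derived G (carrier G)" and y: "y \<in> derived G (carrier G)"
  shows "x \<otimes> y = y \<otimes> x"
proof (rule generate_commuting)
  show "derived_set G (carrier G) \<subseteq> carrier G" by (rule derived_set_in_carrier) simp
  show "x \<in> generate G (derived_set G (carrier G))" "y \<in> generate G (derived_set G (carrier G))"
    using x y by (simp_all add: derived_def)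
  fix c d assume c: "c \<in> derived_set G (carrier G)" and d: "d \<in> derived_set G (carrier G)"
  have cc: "c \<in> carrier G" and dc: "d \<in> carrier G" using c d by auto
  have "c \<otimes> d \<otimes> inv c \<otimes> inv d \<in> {\<one>}"
    by (rule commutators_commute_mod_hall[OF fin orders c d one_is_normal]) simp
  then have "c \<otimes> d = \<one> \<otimes> d \<otimes> c"
    using cc dc by (metis inv_closed inv_solve_right m_closed one_closed singletonD)
  then show "c \<otimes> d = d \<otimes> c" using dc by simp
qed

section \<open>Commuting pairs generate cyclic subgroups\<close>

text \<open>
The subgroup generated by \<open>x\<close> and \<open>y\<close> is abelian and has an element of every prime power order dividing
its order.  Multiplying such elements for the different primes yields elements of every order dividing
that of the subgroup, in particular a generator.
\<close>
lemma (in group) commuting_pair_cyclic: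
  assumes fin: "finite (carrier G)" and orders: "has_prime_power_orders G"
    and x: "x \<in> carrier G" and y: "y \<in> carrier G" and xy: "x \<otimes> y = y \<otimes> x"
  shows "cyclic_group (subgroup_generated G {x, y})"
proof -
  let ?H = "generate G {x, y}"
  have H: "subgroup ?H G" using generate_is_subgroup[of "{x, y}"] x y by simp
  have comm: "u \<otimes> v = v \<otimes> u" if "u \<in> ?H" "v \<in> ?H" for u v
    by (rule generate_commuting[OF _ _ that]) (use x y xy in auto)
  have finH: "finite ?H" using subgroup.subset[OF H] fin finite_subset by blast
  have elements: "n dvd card ?H \<Longrightarrow> \<exists>u\<in>?H. ord u = n" for n
  proof (induction n rule: less_induct)
    case (less n)
    have "n > 0" using less.prems finH subgroup.one_closed[OF H] by (intro Nat.gr0I) auto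
    show ?case
    proof (cases "n = 1")
      case True
      then show ?thesis using subgroup.one_closed[OF H] ord_id by blast
    next
      case False
      then obtain p where p: "Factorial_Ring.prime p" "p dvd n" using prime_factor_nat by blast
      obtain m where m: "n = p ^ multiplicity p n * m" "\<not> p dvd m"
        using multiplicity_decompose'[of n p] \<open>n > 0\<close> prime_gt_1_nat[OF p(1)] by auto
      define e where "e = multiplicity p n"
      have n_eq: "n = p ^ e * m" using m by (simp add: e_def)
      have "e > 0" using m p(2) by (cases "e = 0") (auto simp: e_def)
      then have "p ^ e > 1" using one_less_power[OF prime_gt_1_nat[OF p(1)]] by blast
      then have "m < n" using n_eq \<open>n > 0\<close> by (cases "m = 0") auto
      moreover have "m dvd card ?H" using less.prems n_eq by (metis dvd_mult_right)
      ultimately obtain v where v: "v \<in> ?H" "ord v = m" using less.IH by blast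
      have "p ^ e dvd card ?H" using less.prems n_eq by (metis dvd_mult_left)
      then obtain u where u: "u \<in> ?H" "ord u = p ^ e"
        using orders H p(1) unfolding has_prime_power_orders_def by blast
      have "coprime (ord u) (ord v)"
        using u v prime_imp_coprime[OF p(1) m(2)] by simp
      then have "ord (u \<otimes> v) = n"
        using ord_mult_coprime[of u v] subgroup.mem_carrier[OF H] u v comm n_eq by simp
      then show ?thesis using subgroup.m_closed[OF H u(1) v(1)] by blast
    qed
  qed
  obtain u where u: "u \<in> ?H" "ord u = card ?H" using elements[OF dvd_refl] by auto
  have uc: "u \<in> carrier G" using subgroup.mem_carrier[OF H u(1)] .
  have "generate G {u} = ?H"
    by (rule card_subset_eq[OF finH])
      (use generate_subgroup_incl[OF _ H, of "{u}"] u generate_pow_card[OF uc] in simp_all)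
  then have "subgroup_generated G {x, y} = subgroup_generated G {u}"
    using x y uc by (simp add: subgroup_generated_def)
  then show ?thesis using cyclic_group_generated by simp
qed

lemma (in group) cyclic_pair_commutes:
  assumes x: "x \<in> carrier G" and y: "y \<in> carrier G"
    and cyc: "cyclic_group (subgroup_generated G {x, y})"
  shows "x \<otimes> y = y \<otimes> x"
proof -
  interpret K: comm_group "subgroup_generated G {x, y}"
    using group.cyclic_imp_abelian_group[OF group_subgroup_generated cyc] .
  have "x \<in> carrier (subgroup_generated G {x, y})" "y \<in> carrier (subgroup_generated G {x, y})"
    using x y by (auto simp: carrier_subgroup_generated intro: generate.incl)
  then show ?thesis using K.m_comm by simp
qed

section \<open>Common neighbours in the commuting graph\<close>

text \<open>
If \<open>x\<close> centralizes no nonidentity element of \<open>A\<close>, then \<open>f \<mapsto> [f, x]\<close> is injective on \<open>A\<close>: equal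
values at \<open>f\<close> and \<open>g\<close> mean that \<open>g^(-1) f\<close> commutes with \<open>x\<close>.  It is thus a bijection of the finite
set \<open>A\<close>, so the commutator \<open>[b^(-1), x]\<close> is one of its values \<open>[f, x]\<close>, and this equation says that
\<open>b f\<close> commutes with \<open>x\<close>.
\<close>
lemma (in group) exists_commuting_translate:
  assumes A: "A \<lhd> G" and fin: "finite A" and derived: "derived_set G (carrier G) \<subseteq> A"
    and x: "x \<in> carrier G" and b: "b \<in> carrier G"
    and free: "\<And>a. a \<in> A \<Longrightarrow> x \<otimes> a = a \<otimes> x \<Longrightarrow> a = \<one>"
  shows "\<exists>f\<in>A. x \<otimes> (b \<otimes> f) = b \<otimes> f \<otimes> x"
proof -
  have As: "subgroup A G" using A by (rule normal_imp_subgroup)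
  note Ac = subgroup.mem_carrier[OF As]
  define \<phi> where "\<phi> f = f \<otimes> x \<otimes> inv f \<otimes> inv x" for f
  have inj: "inj_on \<phi> A"
  proof (rule inj_onI)
    fix f g assume fA: "f \<in> A" and gA: "g \<in> A" and eq: "\<phi> f = \<phi> g"
    have fc: "f \<in> carrier G" and gc: "g \<in> carrier G" using Ac fA gA by auto
    have fg: "f \<otimes> x \<otimes> inv f = g \<otimes> x \<otimes> inv g"
      using eq fc gc x by (simp add: \<phi>_def)
    have "inv g \<otimes> f \<otimes> x = inv g \<otimes> (f \<otimes> x \<otimes> inv f) \<otimes> f"
      using fc gc x by (simp add: m_assoc)
    also have "\<dots> = x \<otimes> (inv g \<otimes> f)"
      unfolding fg using fc gc x by (simp add: m_assoc inv_cancel_left)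
    finally have "inv g \<otimes> f = \<one>"
      using free[of "inv g \<otimes> f"] fA gA As by (simp add: subgroup.m_closed subgroup.m_inv_closed)
    then show "f = g" using fc gc by (metis inv_equality inv_inv inv_closed)
  qed
  have into: "\<phi> ` A \<subseteq> A"
  proof (rule image_subsetI)
    fix f assume fA: "f \<in> A"
    have fc: "f \<in> carrier G" using Ac fA by blast
    have "\<phi> f = f \<otimes> (x \<otimes> inv f \<otimes> inv x)" using fc x by (simp add: \<phi>_def m_assoc)
    then show "\<phi> f \<in> A"
      using normal.inv_op_closed2[OF A x, of "inv f"] fA As
      by (simp add: subgroup.m_closed subgroup.m_inv_closed)
  qed
  have surj: "\<phi> ` A = A" using endo_inj_surj[OF fin into inj] .
  have "inv b \<otimes> x \<otimes> inv (inv b) \<otimes> inv x \<in> derived_set G (carrier G)"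
    by (intro UN_I[of "inv b"] UN_I[of x] singletonI inv_closed b x)
  then have "inv b \<otimes> x \<otimes> b \<otimes> inv x \<in> \<phi> ` A"
    using derived b by (auto simp only: surj inv_inv)
  then obtain f where f: "f \<in> A" "inv b \<otimes> x \<otimes> b \<otimes> inv x = \<phi> f" by (rule imageE)
  have fc: "f \<in> carrier G" using Ac f by blast
  have eq: "inv b \<otimes> x \<otimes> b = f \<otimes> x \<otimes> inv f"
    using f(2) fc b x by (simp add: \<phi>_def)
  have "x \<otimes> (b \<otimes> f) = b \<otimes> (inv b \<otimes> x \<otimes> b) \<otimes> f"
    using b x fc by (simp add: m_assoc inv_cancel_left)
  also have "\<dots> = b \<otimes> f \<otimes> x"
    unfolding eq using b x fc by (simp add: m_assoc)
  finally show ?thesis using f(1) by blast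
qed

text \<open>
The point is that \<open>z\<close> does not depend on \<open>x\<close>: whichever translate \<open>b f\<close> is needed, it centralizes the same
elements of the abelian group \<open>A\<close> as \<open>b\<close> does.
\<close>
lemma (in group) exists_common_neighbour:
  assumes A: "A \<lhd> G" and fin: "finite A" and derived: "derived_set G (carrier G) \<subseteq> A"
    and abelian: "\<And>f g. f \<in> A \<Longrightarrow> g \<in> A \<Longrightarrow> f \<otimes> g = g \<otimes> f"
    and b: "b \<in> carrier G - A" and z: "z \<in> A" and bz: "b \<otimes> z = z \<otimes> b"
    and x: "x \<in> carrier G"
  shows "\<exists>y\<in>carrier G - {\<one>}. x \<otimes> y = y \<otimes> x \<and> y \<otimes> z = z \<otimes> y"
proof (cases "\<exists>a\<in>A. a \<noteq> \<one> \<and> x \<otimes> a = a \<otimes> x")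
  case True
  then obtain a where a: "a \<in> A" "a \<noteq> \<one>" "x \<otimes> a = a \<otimes> x" by blast
  then show ?thesis using abelian[OF a(1) z] subgroup.mem_carrier[OF normal_imp_subgroup[OF A]] by blast
next
  case False
  have As: "subgroup A G" using A by (rule normal_imp_subgroup)
  note Ac = subgroup.mem_carrier[OF As]
  obtain f where f: "f \<in> A" "x \<otimes> (b \<otimes> f) = b \<otimes> f \<otimes> x"
    using exists_commuting_translate[OF A fin derived x, of b] b False by blast
  have fc: "f \<in> carrier G" and zc: "z \<in> carrier G" and bc: "b \<in> carrier G" using Ac f z b by auto
  have "b \<otimes> f \<noteq> \<one>"
  proof
    assume "b \<otimes> f = \<one>"
    then have "b = inv f" using fc bc inv_equality by metis
    then show False using b f subgroup.m_inv_closed[OF As] by blast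
  qed
  moreover have "b \<otimes> f \<otimes> z = z \<otimes> (b \<otimes> f)"
  proof -
    have "b \<otimes> f \<otimes> z = (b \<otimes> z) \<otimes> f" using abelian[OF f(1) z] fc zc bc by (simp add: m_assoc)
    also have "\<dots> = z \<otimes> (b \<otimes> f)" unfolding bz using fc zc bc by (simp add: m_assoc)
    finally show ?thesis .
  qed
  ultimately show ?thesis using f fc bc by blast
qed

section \<open>The diameter of the cyclic graph\<close>

text \<open>
Consecutive elements of the path may coincide, so that shorter paths are covered too.
\<close>
lemma graph_dist_le_4_if_commuting_path:
  fixes G (structure)
  assumes G: "group G" and fin: "finite (carrier G)" and orders: "has_prime_power_orders G"
    and V: "x \<in> carrier G - {\<one>}" "u \<in> carrier G - {\<one>}" "z \<in> carrier G - {\<one>}"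
      "v \<in> carrier G - {\<one>}" "y \<in> carrier G - {\<one>}"
    and comm: "x \<otimes> u = u \<otimes> x" "u \<otimes> z = z \<otimes> u" "z \<otimes> v = v \<otimes> z" "v \<otimes> y = y \<otimes> v"
  shows "graph_dist (with_proj (cyclic_graph G)) x y \<le> 4"
proof -
  interpret group G by (rule G)
  interpret D: pair_graph "cyclic_graph G" by (rule pair_graph_cyclic_graph[OF fin])
  have step: "\<exists>p. D.awalk s p t \<and> length p \<le> 1"
    if st: "s \<in> carrier G - {\<one>}" "t \<in> carrier G - {\<one>}" "s \<otimes> t = t \<otimes> s" for s t
  proof (cases "s = t")
    case True
    have "t \<in> pverts (cyclic_graph G)" using st by (simp add: cyclic_graph_def)
    then have "D.awalk s [] t" using True by (simp add: D.awalk_Nil_iff)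
    then show ?thesis by auto
  next
    case False
    then have "(s, t) \<in> parcs (cyclic_graph G)"
      using st commuting_pair_cyclic[OF fin orders] by (simp add: cyclic_graph_def)
    then have "D.awalk s [(s, t)] t" using D.arc_implies_awalk[of "(s, t)"] by simp
    then show ?thesis by (intro exI[of _ "[(s, t)]"]) simp
  qed
  obtain p1 where p1: "D.awalk x p1 u" "length p1 \<le> 1" using step[OF V(1,2) comm(1)] by blast
  obtain p2 where p2: "D.awalk u p2 z" "length p2 \<le> 1" using step[OF V(2,3) comm(2)] by blast
  obtain p3 where p3: "D.awalk z p3 v" "length p3 \<le> 1" using step[OF V(3,4) comm(3)] by blast
  obtain p4 where p4: "D.awalk v p4 y" "length p4 \<le> 1" using step[OF V(4,5) comm(4)] by blast
  let ?p = "p1 @ p2 @ p3 @ p4"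
  have walk: "D.awalk x ?p y"
    using D.awalk_appendI[OF p1(1) D.awalk_appendI[OF p2(1) D.awalk_appendI[OF p3(1) p4(1)]]] .
  have "D.awalk_cost (\<lambda>_. 1) ?p = real (length ?p)"
    by (simp add: D.awalk_cost_def sum_list_triv)
  also have "\<dots> \<le> 4" using p1(2) p2(2) p3(2) p4(2) by simp
  finally have "ereal (D.awalk_cost (\<lambda>_. 1) ?p) \<le> 4" by simp
  then show ?thesis
    unfolding graph_dist_def using D.min_cost_le_walk_cost[OF walk, of "\<lambda>_. 1"] by (rule order_trans[rotated])
qed

lemma connected_closed_set_contains_vertices:
  assumes fin: "finite (carrier G)"
    and conn: "Digraph_Component.connected (with_proj (cyclic_graph G))"
    and a: "a \<in> A" "a \<in> pverts (cyclic_graph G)"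
    and closed: "\<And>s t. s \<in> A \<Longrightarrow> (s, t) \<in> parcs (cyclic_graph G) \<Longrightarrow> t \<in> A"
  shows "pverts (cyclic_graph G) \<subseteq> A"
proof
  interpret D: pair_graph "cyclic_graph G" by (rule pair_graph_cyclic_graph[OF fin])
  fix v assume v: "v \<in> pverts (cyclic_graph G)"
  have "a \<rightarrow>\<^sup>*\<^bsub>mk_symmetric (with_proj (cyclic_graph G))\<^esub> v"
    using conn a(2) v by (simp add: connected_def strongly_connected_def)
  then have "a \<rightarrow>\<^sup>*\<^bsub>with_proj (cyclic_graph G)\<^esub> v"
    using D.reachable_mk_symmetric_eq[OF D.sym_arcs] by simp
  then show "v \<in> A"
    by (induction rule: D.reachable_induct) (use a closed in auto)
qed

theorem theorem2:
  fixes G :: "('a, 'b) monoid_scheme"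
  assumes "finite (carrier G)"
    and "Z_group G"
    and "Digraph_Component.connected (with_proj (cyclic_graph G))"
  shows "diam (with_proj (cyclic_graph G)) \<le> 4"
proof -
  interpret group G using assms(2) by (simp add: Z_group_def)
  note orders = Z_group_has_prime_power_orders[OF assms(1,2)]
  define A where "A = derived G (carrier G)"
  have A: "A \<lhd> G" unfolding A_def by (rule derived_self_is_normal)
  have As: "subgroup A G" using A by (rule normal_imp_subgroup)
  note Ac = subgroup.mem_carrier[OF As]
  have derived: "derived_set G (carrier G) \<subseteq> A" by (auto simp: A_def derived_def intro: generate.incl)
  have abelian: "f \<otimes>\<^bsub>G\<^esub> g = g \<otimes>\<^bsub>G\<^esub> f" if "f \<in> A" "g \<in> A" for f g
    using derived_commuting[OF assms(1) orders] that by (simp add: A_def)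
  have verts: "pverts (cyclic_graph G) = carrier G - {\<one>\<^bsub>G\<^esub>}" by (simp add: cyclic_graph_def)
  have dist: "graph_dist (with_proj (cyclic_graph G)) x y \<le> 4"
    if x: "x \<in> carrier G - {\<one>\<^bsub>G\<^esub>}" and y: "y \<in> carrier G - {\<one>\<^bsub>G\<^esub>}" for x y
  proof (cases "\<exists>b\<in>carrier G - A. \<exists>z\<in>A. z \<noteq> \<one>\<^bsub>G\<^esub> \<and> b \<otimes>\<^bsub>G\<^esub> z = z \<otimes>\<^bsub>G\<^esub> b")
    case True
    then obtain b z where b: "b \<in> carrier G - A" and z: "z \<in> A" "z \<noteq> \<one>\<^bsub>G\<^esub>" "b \<otimes>\<^bsub>G\<^esub> z = z \<otimes>\<^bsub>G\<^esub> b"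
      by blast
    have finA: "finite A" using assms(1) subgroup.subset[OF As] finite_subset by blast
    note common = exists_common_neighbour[OF A finA derived abelian b z(1,3)]
    obtain u where u: "u \<in> carrier G - {\<one>\<^bsub>G\<^esub>}" "x \<otimes>\<^bsub>G\<^esub> u = u \<otimes>\<^bsub>G\<^esub> x" "u \<otimes>\<^bsub>G\<^esub> z = z \<otimes>\<^bsub>G\<^esub> u"
      using common[of x] x by blast
    obtain v where v: "v \<in> carrier G - {\<one>\<^bsub>G\<^esub>}" "y \<otimes>\<^bsub>G\<^esub> v = v \<otimes>\<^bsub>G\<^esub> y" "v \<otimes>\<^bsub>G\<^esub> z = z \<otimes>\<^bsub>G\<^esub> v"
      using common[of y] y by blast
    have "z \<in> carrier G - {\<one>\<^bsub>G\<^esub>}" using z Ac by blast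
    then show ?thesis
      using graph_dist_le_4_if_commuting_path[OF is_group assms(1) orders x u(1) _ v(1) y u(2,3) v(3)[symmetric] v(2)[symmetric]]
      by blast
  next
    case False
    \<comment> \<open>The nonidentity elements of \<open>A\<close> have no neighbours outside \<open>A\<close>; if there are any, then by
      connectedness \<open>G = A\<close>.\<close>
    have "x \<otimes>\<^bsub>G\<^esub> y = y \<otimes>\<^bsub>G\<^esub> x"
    proof (cases "A = {\<one>\<^bsub>G\<^esub>}")
      case True
      have "x \<otimes>\<^bsub>G\<^esub> y \<otimes>\<^bsub>G\<^esub> inv\<^bsub>G\<^esub> x \<otimes>\<^bsub>G\<^esub> inv\<^bsub>G\<^esub> y \<in> derived_set G (carrier G)"
        using x y by blast
      then have "x \<otimes>\<^bsub>G\<^esub> y \<otimes>\<^bsub>G\<^esub> inv\<^bsub>G\<^esub> x \<otimes>\<^bsub>G\<^esub> inv\<^bsub>G\<^esub> y = \<one>\<^bsub>G\<^esub>"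
        using derived True by blast
      then have "x \<otimes>\<^bsub>G\<^esub> y = \<one>\<^bsub>G\<^esub> \<otimes>\<^bsub>G\<^esub> y \<otimes>\<^bsub>G\<^esub> x"
        using x y by (metis DiffD1 inv_closed inv_solve_right m_closed one_closed)
      then show ?thesis using y by simp
    next
      case nontriv: False
      then obtain a where a: "a \<in> A" "a \<noteq> \<one>\<^bsub>G\<^esub>" using subgroup.one_closed[OF As] by blast
      have "pverts (cyclic_graph G) \<subseteq> A - {\<one>\<^bsub>G\<^esub>}"
      proof (rule connected_closed_set_contains_vertices[OF assms(1,3)])
        show "a \<in> A - {\<one>\<^bsub>G\<^esub>}" using a by blast
        show "a \<in> pverts (cyclic_graph G)" using a Ac by (simp add: verts)
        fix s t assume s: "s \<in> A - {\<one>\<^bsub>G\<^esub>}" and st: "(s, t) \<in> parcs (cyclic_graph G)"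
        then have t: "t \<in> carrier G - {\<one>\<^bsub>G\<^esub>}" "cyclic_group (subgroup_generated G {s, t})"
          by (auto simp: cyclic_graph_def)
        have "t \<otimes>\<^bsub>G\<^esub> s = s \<otimes>\<^bsub>G\<^esub> t"
          using cyclic_pair_commutes[OF Ac _ t(2)] s t(1) by simp
        with False s t(1) have "t \<in> A" by (metis DiffD1 DiffD2 DiffI singletonI)
        with t(1) show "t \<in> A - {\<one>\<^bsub>G\<^esub>}" by blast
      qed
      then show ?thesis using abelian x y verts by blast
    qed
    then show ?thesis
      using graph_dist_le_4_if_commuting_path[OF is_group assms(1) orders x x x x y refl refl refl] by blast
  qed
  show ?thesis
    unfolding diam_def by (rule SUP_least) (use dist verts in auto)
qed

end
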